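(* Let $\pi$ be any uniformly good policy (in the sense defined in the context) for the Gaussian multi-armed bandit with surrogate rewards. Then for every instance $\theta$, $$\liminf_{T\to\infty}\frac{\mathbb{E}^\pi_\theta[\mathrm{Reg}_T]}{\log T}\ \ge\ \sum_{k\ne k^\star}\frac{2\Delta_k}{\log\left(1+\dfrac{\Delta_k^2}{\sigma_k^2(1-\rho_k^2)}\right)}.$$
   Context: **Model.** There are $K\ge2$ arms. An instance is $\theta=(\{\mu_k,\tilde\mu_k,\Sigma_k\}_{k=1}^K)$ with $\mu_k,\tilde\mu_k\in\mathbb{R}$ and $\Sigma_k=\begin{pmatrix}\sigma_k^2&\rho_k\sigma_k\tilde\sigma_k\\ \rho_k\sigma_k\tilde\sigma_k&\tilde\sigma_k^2\end{pmatrix}$, $\sigma_k,\tilde\sigma_k>0$, $|\rho_k|<1$, and with distinct means $\mu_i\neq\mu_j$ for $i\ne j$. Under $\theta$, the online pairs of true and surrogate rewards $(R_{k,s},\hat R_{k,s})$, $s=1,2,\dots$, are i.i.d. $\mathcal N((\mu_k,\tilde\mu_k),\Sigma_k)$, independently across arms. The learner also has for each arm $k$ a finite pool of $N_k$ offline surrogate rewards $\hat R^{\mathrm{off}}_{k,1},\dots,\hat R^{\mathrm{off}}_{k,N_k}$, i.i.d. $\mathcal N(\tilde\mu_k,\tilde\sigma_k^2)$, independent of the online pairs (and across arms). The sizes $N_k$ are arbitrary. At each round $t=1,\dots,T$, a policy $\pi$ chooses an arm $A_t\in\{1,\dots,K\}$ based on the offline data and the arms, true rewards and surrogate rewards observed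 in rounds $1,\dots,t-1$; when arm $k$ is pulled for the $s$-th time the pair $(R_{k,s},\hat R_{k,s})$ is observed. $\mathbb{E}^\pi_\theta$ is expectation under instance $\theta$ and policy $\pi$. Let $\mu^\star=\max_k\mu_k$, $k^\star=\arg\max_k\mu_k$, $\Delta_k=\mu^\star-\mu_k$, $\mathrm{Reg}_T=\sum_{t=1}^T(\mu^\star-\mu_{A_t})$. **Uniformly good policy.** $\pi$ is uniformly good if for every instance $\theta$ and every $a>0$, $\mathbb{E}^\pi_\theta[\mathrm{Reg}_T]=o(T^a)$ as $T\to\infty$. *)

theory Defs
  imports "HOL-Probability.Probability"
begin

text \<open>
  \<open>smean\<close> and \<open>ssd\<close> are the mean and standard deviation of the surrogate reward, \<open>corr\<close> its
  correlation with the true reward.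
\<close>

record 'k bandit =
  mean :: "'k \<Rightarrow> real"
  smean :: "'k \<Rightarrow> real"
  sd :: "'k \<Rightarrow> real"
  ssd :: "'k \<Rightarrow> real"
  corr :: "'k \<Rightarrow> real"

definition bandit_instance :: "('k::finite) bandit \<Rightarrow> bool" where
  "bandit_instance \<theta> \<longleftrightarrow>
     (\<forall>k. 0 < sd \<theta> k \<and> 0 < ssd \<theta> k \<and> \<bar>corr \<theta> k\<bar> < 1) \<and> inj (mean \<theta>)"

definition cov_matrix :: "'k bandit \<Rightarrow> 'k \<Rightarrow> real^2^2" where
  "cov_matrix \<theta> k = vector
     [vector [(sd \<theta> k)\<^sup>2, corr \<theta> k * sd \<theta> k * ssd \<theta> k],
      vector [corr \<theta> k * sd \<theta> k * ssd \<theta> k, (ssd \<theta> k)\<^sup>2]]"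

definition normal2_density :: "real \<times> real \<Rightarrow> real^2^2 \<Rightarrow> real \<times> real \<Rightarrow> real" where
  "normal2_density m S z =
     (let v = vector [fst z - fst m, snd z - snd m] :: real^2
      in exp (- (v \<bullet> (matrix_inv S *v v)) / 2) / (2 * pi * sqrt (det S)))"

definition normal2 :: "real \<times> real \<Rightarrow> real^2^2 \<Rightarrow> (real \<times> real) measure" where
  "normal2 m S = density lborel (normal2_density m S)"

definition online_law :: "'k bandit \<Rightarrow> 'k \<Rightarrow> (real \<times> real) measure" where
  "online_law \<theta> k = normal2 (mean \<theta> k, smean \<theta> k) (cov_matrix \<theta> k)"

definition offline_law :: "'k bandit \<Rightarrow> 'k \<Rightarrow> real measure" where
  "offline_law \<theta> k = density lborel (normal_density (smean \<theta> k) (ssd \<theta> k))"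

text \<open>Marginal density of the surrogate reward times conditional density of the true reward.\<close>

lemma normal2_density_cov_matrix:
  assumes "bandit_instance \<theta>"
  shows "normal2_density (mean \<theta> k, smean \<theta> k) (cov_matrix \<theta> k) (x, y) =
    normal_density (smean \<theta> k) (ssd \<theta> k) y *
    normal_density (mean \<theta> k + corr \<theta> k * sd \<theta> k / ssd \<theta> k * (y - smean \<theta> k))
      (sd \<theta> k * sqrt (1 - (corr \<theta> k)\<^sup>2)) x"
proof -
  define s s' r where "s = sd \<theta> k" and "s' = ssd \<theta> k" and "r = corr \<theta> k"
  define p q where "p = x - mean \<theta> k" and "q = y - smean \<theta> k"
  have pos: "s > 0" "s' > 0" and "\<bar>r\<bar> < 1"
    using assms by (auto simp: bandit_instance_def s_def s'_def r_def)
  then have r: "1 - r\<^sup>2 > 0"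
    by (simp add: abs_square_less_1)
  define D where "D = s\<^sup>2 * s'\<^sup>2 * (1 - r\<^sup>2)"
  have D: "D > 0"
    using pos r by (simp add: D_def)
  define S :: "real^2^2" where "S = cov_matrix \<theta> k"
  define B :: "real^2^2" where
    "B = vector [vector [s'\<^sup>2 / D, - (r * s * s') / D], vector [- (r * s * s') / D, s\<^sup>2 / D]]"
  have S_eq: "S = vector [vector [s\<^sup>2, r * s * s'], vector [r * s * s', s'\<^sup>2]]"
    by (simp add: S_def cov_matrix_def s_def s'_def r_def)
  have D_alt: "s\<^sup>2 * s'\<^sup>2 - (r * s * s') * (r * s * s') = D"
    by (simp add: D_def algebra_simps power2_eq_square)
  have det: "det S = D"
    using D_alt by (simp add: S_eq det_2)
  have prods: "S ** B = mat 1" "B ** S = mat 1"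
    using D D_alt
    by (simp_all add: S_eq B_def vec_eq_iff forall_2 matrix_matrix_mult_def sum_2 mat_def
        field_simps power2_eq_square)
  have "S ** matrix_inv S = mat 1 \<and> matrix_inv S ** S = mat 1"
    unfolding matrix_inv_def by (rule someI[of _ B]) (use prods in simp)
  then have inv: "matrix_inv S = B"
    by (metis prods(2) matrix_mul_assoc matrix_mul_lid matrix_mul_rid)
  have quad: "(vector [p, q] :: real^2) \<bullet> (B *v vector [p, q]) =
      q\<^sup>2 / s'\<^sup>2 + (p - r * s / s' * q)\<^sup>2 / (s\<^sup>2 * (1 - r\<^sup>2))"
  proof -
    have "(vector [p, q] :: real^2) \<bullet> (B *v vector [p, q]) =
        (s'\<^sup>2 * p\<^sup>2 - 2 * r * s * s' * p * q + s\<^sup>2 * q\<^sup>2) / D"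
      by (simp add: B_def inner_vec_def sum_2 matrix_vector_mult_def
          add_divide_distrib diff_divide_distrib algebra_simps power2_eq_square)
    also have "\<dots> = q\<^sup>2 / s'\<^sup>2 + (p - r * s / s' * q)\<^sup>2 / (s\<^sup>2 * (1 - r\<^sup>2))"
    proof -
      define c where "c = 1 - r\<^sup>2"
      have "c > 0" using r by (simp add: c_def)
      have r2: "r * r = 1 - c" by (simp add: c_def power2_eq_square)
      have r3: "r * (r * z) = (1 - c) * z" for z
        by (metis mult.assoc r2)
      show ?thesis
        unfolding D_def c_def[symmetric] using pos \<open>c > 0\<close>
        by (simp add: divide_simps power2_eq_square) (simp add: algebra_simps r2 r3)
    qed
    finally show ?thesis .
  qed
  have sq: "2 * pi * sqrt D = sqrt (2 * pi * s'\<^sup>2) * sqrt (2 * pi * (s * sqrt (1 - r\<^sup>2))\<^sup>2)"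
  proof -
    have "sqrt (2 * pi * s'\<^sup>2) = sqrt (2 * pi) * s'"
      and "sqrt (2 * pi * (s * sqrt (1 - r\<^sup>2))\<^sup>2) = sqrt (2 * pi) * (s * sqrt (1 - r\<^sup>2))"
      using pos r by (simp_all add: real_sqrt_mult)
    moreover have "sqrt D = s * s' * sqrt (1 - r\<^sup>2)"
      using pos by (simp add: D_def real_sqrt_mult)
    moreover have "sqrt (2 * pi) * sqrt (2 * pi) = 2 * pi"
      by simp
    ultimately show ?thesis
      by (metis mult.assoc mult.commute)
  qed
  have "normal2_density (mean \<theta> k, smean \<theta> k) S (x, y) =
      exp (- (q\<^sup>2 / s'\<^sup>2 + (p - r * s / s' * q)\<^sup>2 / (s\<^sup>2 * (1 - r\<^sup>2))) / 2) / (2 * pi * sqrt D)"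
    unfolding normal2_density_def Let_def fst_conv snd_conv p_def[symmetric] q_def[symmetric]
      inv det quad ..
  also have "\<dots> = (exp (- q\<^sup>2 / (2 * s'\<^sup>2)) / sqrt (2 * pi * s'\<^sup>2)) *
      (exp (- (p - r * s / s' * q)\<^sup>2 / (2 * (s * sqrt (1 - r\<^sup>2))\<^sup>2)) /
        sqrt (2 * pi * (s * sqrt (1 - r\<^sup>2))\<^sup>2))"
  proof -
    have split: "- (u / a + w / b) / 2 = - u / (2 * a) + - w / (2 * b)" for u w a b :: real
      by (simp add: add_divide_distrib diff_divide_distrib mult.commute)
    have "(s * sqrt (1 - r\<^sup>2))\<^sup>2 = s\<^sup>2 * (1 - r\<^sup>2)"
      using r by (simp add: power_mult_distrib)
    then show ?thesis
      unfolding sq times_divide_times_eq exp_add[symmetric] by (simp only: split)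
  qed
  finally show ?thesis
    by (simp add: normal_density_def S_def p_def q_def s_def s'_def r_def algebra_simps)
qed

lemma prob_space_online_law:
  assumes "bandit_instance \<theta>"
  shows "prob_space (online_law \<theta> k)"
proof -
  let ?c = "\<lambda>y. mean \<theta> k + corr \<theta> k * sd \<theta> k / ssd \<theta> k * (y - smean \<theta> k)"
  let ?v = "sd \<theta> k * sqrt (1 - (corr \<theta> k)\<^sup>2)"
  let ?f = "normal2_density (mean \<theta> k, smean \<theta> k) (cov_matrix \<theta> k)"
  have pos: "ssd \<theta> k > 0" "?v > 0"
    using assms by (auto simp: bandit_instance_def abs_square_less_1)
  have f: "?f = (\<lambda>(x, y). normal_density (smean \<theta> k) (ssd \<theta> k) y * normal_density (?c y) ?v x)"
    using normal2_density_cov_matrix[OF assms] by auto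
  have meas: "(\<lambda>(x, y). normal_density (smean \<theta> k) (ssd \<theta> k) y * normal_density (?c y) ?v x)
      \<in> borel_measurable (borel \<Otimes>\<^sub>M borel)"
    unfolding normal_density_def by measurable
  have one: "(\<integral>\<^sup>+x. ennreal (normal_density m d x) \<partial>lborel) = 1" if "d > 0" for m d
    using prob_space.emeasure_space_1[OF prob_space_normal_density[OF that, of m]]
    by (simp add: emeasure_density)
  have "(\<integral>\<^sup>+z. ennreal (?f z) \<partial>(lborel \<Otimes>\<^sub>M lborel)) =
      (\<integral>\<^sup>+y. \<integral>\<^sup>+x. ennreal (?f (x, y)) \<partial>lborel \<partial>lborel)"
    using meas by (subst lborel_pair.nn_integral_snd[symmetric])
      (simp_all add: f borel_prod cong: measurable_cong_sets)
  also have "\<dots> = (\<integral>\<^sup>+y. ennreal (normal_density (smean \<theta> k) (ssd \<theta> k) y) *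
      (\<integral>\<^sup>+x. ennreal (normal_density (?c y) ?v x) \<partial>lborel) \<partial>lborel)"
    by (simp add: f ennreal_mult nn_integral_cmult)
  also have "\<dots> = 1"
    using pos by (simp add: one)
  finally have "(\<integral>\<^sup>+z. ennreal (?f z) \<partial>lborel) = 1"
    by (simp add: lborel_prod)
  moreover have "?f \<in> borel_measurable lborel"
    using meas by (simp add: f borel_prod)
  ultimately show ?thesis
    unfolding online_law_def normal2_def
    by (intro prob_spaceI) (simp add: emeasure_density)
qed

text \<open>
  Rounds, offline samples and repeated pulls are indexed from 0: round \<open>t\<close> here is
  round \<open>t + 1\<close> in the usual numbering, and \<open>(k, s)\<close> is the pair revealed by pull number
  \<open>s + 1\<close> of arm \<open>k\<close>. Offline data form an extensional function on \<open>offline_index N\<close>,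
  and the observations made before round \<open>t\<close> an extensional function on \<open>{..<t}\<close>.
\<close>

type_synonym 'k offline = "'k \<times> nat \<Rightarrow> real"
type_synonym 'k online = "'k \<times> nat \<Rightarrow> real \<times> real"
type_synonym 'k history = "nat \<Rightarrow> 'k \<times> real \<times> real"

definition offline_index :: "('k \<Rightarrow> nat) \<Rightarrow> ('k \<times> nat) set" where
  "offline_index N = (SIGMA k:UNIV. {..<N k})"

text \<open>
  A policy may randomise: \<open>seed\<close> is the law of its internal randomness, which is independent of
  all rewards. A deterministic policy is one whose \<open>decide\<close> ignores the seed.
\<close>

record ('u, 'k) policy =
  seed :: "'u measure"
  decide :: "nat \<Rightarrow> 'u \<Rightarrow> 'k offline \<Rightarrow> 'k history \<Rightarrow> 'k"

definition is_policy :: "('k::finite \<Rightarrow> nat) \<Rightarrow> ('u, 'k) policy \<Rightarrow> bool" where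
  "is_policy N \<pi> \<longleftrightarrow> prob_space (seed \<pi>) \<and>
     (\<forall>t. (\<lambda>(u, off, h). decide \<pi> t u off h)
        \<in> measurable (seed \<pi> \<Otimes>\<^sub>M (\<Pi>\<^sub>M i\<in>offline_index N. borel) \<Otimes>\<^sub>M
                        (\<Pi>\<^sub>M i\<in>{..<t}. count_space UNIV \<Otimes>\<^sub>M borel \<Otimes>\<^sub>M borel))
                     (count_space UNIV))"

definition bandit_space ::
  "('k::finite \<Rightarrow> nat) \<Rightarrow> 'k bandit \<Rightarrow> ('u, 'k) policy \<Rightarrow> ('u \<times> 'k offline \<times> 'k online) measure"
where
  "bandit_space N \<theta> \<pi> =
     seed \<pi> \<Otimes>\<^sub>M (\<Pi>\<^sub>M (k, i)\<in>offline_index N. offline_law \<theta> k) \<Otimes>\<^sub>M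
       (\<Pi>\<^sub>M (k, s)\<in>UNIV. online_law \<theta> k)"

definition pulls :: "'k history \<Rightarrow> nat \<Rightarrow> 'k \<Rightarrow> nat" where
  "pulls h t k = card {i. i < t \<and> fst (h i) = k}"

primrec history :: "('u, 'k) policy \<Rightarrow> 'u \<times> 'k offline \<times> 'k online \<Rightarrow> nat \<Rightarrow> 'k history" where
  "history \<pi> \<omega> 0 = (\<lambda>_. undefined)"
| "history \<pi> \<omega> (Suc t) =
     (let (u, off, on) = \<omega>;
          h = history \<pi> \<omega> t;
          a = decide \<pi> t u off h
      in h(t := (a, on (a, pulls h t a))))"

definition arm :: "('u, 'k) policy \<Rightarrow> nat \<Rightarrow> 'u \<times> 'k offline \<times> 'k online \<Rightarrow> 'k" where
  "arm \<pi> t \<omega> = (let (u, off, on) = \<omega> in decide \<pi> t u off (history \<pi> \<omega> t))"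

definition best_mean :: "('k::finite) bandit \<Rightarrow> real" where
  "best_mean \<theta> = (MAX k. mean \<theta> k)"

definition best_arm :: "('k::finite) bandit \<Rightarrow> 'k" where
  "best_arm \<theta> = (ARG_MAX (mean \<theta>) k. True)"

definition gap :: "('k::finite) bandit \<Rightarrow> 'k \<Rightarrow> real" where
  "gap \<theta> k = best_mean \<theta> - mean \<theta> k"

definition regret ::
  "('k::finite) bandit \<Rightarrow> ('u, 'k) policy \<Rightarrow> nat \<Rightarrow> 'u \<times> 'k offline \<times> 'k online \<Rightarrow> real" where
  "regret \<theta> \<pi> T \<omega> = (\<Sum>t<T. best_mean \<theta> - mean \<theta> (arm \<pi> t \<omega>))"

definition expected_regret ::
  "('k::finite \<Rightarrow> nat) \<Rightarrow> 'k bandit \<Rightarrow> ('u, 'k) policy \<Rightarrow> nat \<Rightarrow> real" where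
  "expected_regret N \<theta> \<pi> T = (\<integral>\<omega>. regret \<theta> \<pi> T \<omega> \<partial>bandit_space N \<theta> \<pi>)"

text \<open>The pool sizes \<open>N\<close> are known to the policy and fixed; only the instance varies.\<close>

definition uniformly_good :: "('k::finite \<Rightarrow> nat) \<Rightarrow> ('u, 'k) policy \<Rightarrow> bool" where
  "uniformly_good N \<pi> \<longleftrightarrow>
     (\<forall>\<theta>. bandit_instance \<theta> \<longrightarrow>
       (\<forall>a>0. expected_regret N \<theta> \<pi> \<in> o(\<lambda>T. real T powr a)))"

end

theory Submission
  imports Defs
begin

text \<open>
  The argument is a change of measure in the style of Lai and Robbins, against an alternative
  chosen to be invisible in every surrogate reward. Fix a suboptimal arm \<open>k\<close>, let \<open>v\<^sup>2 =
  \<sigma>\<^sub>k\<^sup>2 (1 - \<rho>\<^sub>k\<^sup>2)\<close> be the conditional variance of the true reward given the surrogate, and let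
  \<open>\<delta> = \<Delta>\<^sub>k + \<epsilon>\<close>. Write a reward of arm \<open>k\<close> as its conditional mean given the surrogate plus a
  residual, which is \<open>N(0, v\<^sup>2)\<close>. The alternative \<open>raise_arm\<close> keeps the law of the surrogate and
  the regression slope, and replaces the residual law by \<open>N(\<delta>, v\<^sup>2 + \<delta>\<^sup>2)\<close>. Then the arm becomes
  optimal by a margin \<open>\<epsilon>\<close>; the offline data carry no information about the change, whatever the
  pool sizes; and one pull carries \<open>d = ln (1 + \<delta>\<^sup>2 / v\<^sup>2) / 2\<close> of relative entropy. Inflating the
  variance together with the mean is what turns the quadratic \<open>\<delta>\<^sup>2 / (2 v\<^sup>2)\<close> of a pure shift into
  the smaller logarithm: for a shift by \<open>\<delta>\<close>, the value \<open>v\<^sup>2 + \<delta>\<^sup>2\<close> of the new variance is the one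
  that minimises the divergence.

  A policy with small regret under both instances must tell them apart: it plays \<open>k\<close> rarely under
  the first and almost always under the second. With \<open>L\<close> the likelihood ratio of the trajectory up
  to time \<open>T\<close>, the event \<open>A\<close> that \<open>k\<close> is played at least \<open>T/2\<close> times satisfies
  \<open>P(A) + P'(not A) \<ge> E (min 1 L)\<close>, and by convexity the right-hand side is at least
  \<open>exp (- E (-ln L) - 1)\<close>. The entropy \<open>E (-ln L)\<close> is the expected number of pulls of \<open>k\<close>
  times \<open>d\<close>. Markov's inequality bounds the left-hand side by a multiple of the regrets divided by
  \<open>T\<close>, hence by \<open>T\<close> to a power close to \<open>-1\<close>. So arm \<open>k\<close> is pulled about \<open>ln T / d\<close> times at
  least; letting \<open>\<epsilon>\<close> tend to 0 and summing over the suboptimal arms gives the theorem.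

  The change of measure (lemma \<open>change_of_measure\<close>) has to be carried out on the random trajectory
  and not on the infinite table of rewards from which it is read, since the tables of the two
  instances are not absolutely continuous. The link is lemma \<open>nn_integral_fresh_observation\<close>:
  given the past, the entry of the table revealed next has the law of the chosen arm, because
  resampling an entry that has not been revealed does not alter the past.
\<close>

section \<open>Trajectories as functions of the reward table\<close>

text \<open>
  The past before round \<open>t\<close> comprises the seed and the offline data, so that the decision
  in round \<open>t\<close> is a function of it.
\<close>

definition past_algebra ::
  "('k::finite \<Rightarrow> nat) \<Rightarrow> ('u, 'k) policy \<Rightarrow> nat \<Rightarrow> ('u \<times> 'k offline \<times> 'k history) measure" where
  "past_algebra N \<pi> t = seed \<pi> \<Otimes>\<^sub>M (\<Pi>\<^sub>M i\<in>offline_index N. borel) \<Otimes>\<^sub>M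
     (\<Pi>\<^sub>M i\<in>{..<t}. count_space UNIV \<Otimes>\<^sub>M borel \<Otimes>\<^sub>M borel)"

definition past :: "('u, 'k) policy \<Rightarrow> nat \<Rightarrow> 'u \<times> 'k offline \<times> 'k online \<Rightarrow> 'u \<times> 'k offline \<times> 'k history"
  where "past \<pi> t \<omega> = (fst \<omega>, fst (snd \<omega>), history \<pi> \<omega> t)"

definition choice :: "('u, 'k) policy \<Rightarrow> nat \<Rightarrow> 'u \<times> 'k offline \<times> 'k history \<Rightarrow> 'k" where
  "choice \<pi> t p = (case p of (u, off, h) \<Rightarrow> decide \<pi> t u off h)"

definition next_pull :: "('u, 'k) policy \<Rightarrow> nat \<Rightarrow> 'u \<times> 'k offline \<times> 'k history \<Rightarrow> 'k \<times> nat" where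
  "next_pull \<pi> t p = (choice \<pi> t p, pulls (snd (snd p)) t (choice \<pi> t p))"

definition extend_past ::
  "('u, 'k) policy \<Rightarrow> nat \<Rightarrow> 'u \<times> 'k offline \<times> 'k history \<Rightarrow> real \<times> real \<Rightarrow> 'u \<times> 'k offline \<times> 'k history"
  where "extend_past \<pi> t p z = (fst p, fst (snd p), (snd (snd p))(t := (choice \<pi> t p, z)))"

lemma past_0: "past \<pi> 0 \<omega> = (fst \<omega>, fst (snd \<omega>), \<lambda>_. undefined)"
  by (simp add: past_def)

lemma arm_eq_choice: "arm \<pi> t \<omega> = choice \<pi> t (past \<pi> t \<omega>)"
  by (cases \<omega>) (simp add: arm_def choice_def past_def)

lemma past_Suc: "past \<pi> (Suc t) \<omega> = extend_past \<pi> t (past \<pi> t \<omega>) (snd (snd \<omega>) (next_pull \<pi> t (past \<pi> t \<omega>)))"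
  by (cases \<omega>) (simp add: past_def extend_past_def next_pull_def choice_def Let_def)

lemma pulls_fun_upd: "pulls (h(t := (a, x))) (Suc t) k = pulls h t k + (if a = k then 1 else 0)"
proof -
  have "{i. i < Suc t \<and> fst ((h(t := (a, x))) i) = k} =
      (if a = k then insert t {i. i < t \<and> fst (h i) = k} else {i. i < t \<and> fst (h i) = k})"
    by (auto simp: less_Suc_eq)
  then show ?thesis
    by (simp add: pulls_def)
qed

lemma pulls_le: "pulls h t k \<le> t"
proof -
  have "card {i. i < t \<and> fst (h i) = k} \<le> card {..<t}"
    by (intro card_mono) auto
  then show ?thesis by (simp add: pulls_def)
qed

lemma history_Suc:
  "history \<pi> (u, off, on) (Suc t) = (history \<pi> (u, off, on) t)
     (t := (decide \<pi> t u off (history \<pi> (u, off, on) t),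
       on (decide \<pi> t u off (history \<pi> (u, off, on) t),
         pulls (history \<pi> (u, off, on) t) t (decide \<pi> t u off (history \<pi> (u, off, on) t)))))"
  by (simp add: Let_def)

text \<open>
  The first \<open>t\<close> rounds read only the entries \<open>(k, s)\<close> with \<open>s\<close> below the number of pulls of \<open>k\<close>
  made so far; any other entry may be changed without affecting them.
\<close>

lemma history_fun_upd:
  assumes "pulls (history \<pi> (u, off, on) t) t k \<le> s"
  shows "history \<pi> (u, off, on((k, s) := z)) t = history \<pi> (u, off, on) t"
  using assms
proof (induction t)
  case 0
  then show ?case by simp
next
  case (Suc t)
  define a where "a = decide \<pi> t u off (history \<pi> (u, off, on) t)"
  have *: "pulls (history \<pi> (u, off, on) t) t k + (if a = k then 1 else 0) \<le> s"
    using Suc.prems unfolding history_Suc pulls_fun_upd a_def .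
  then have IH: "history \<pi> (u, off, on((k, s) := z)) t = history \<pi> (u, off, on) t"
    by (intro Suc.IH) simp
  have "(a, pulls (history \<pi> (u, off, on) t) t a) \<noteq> (k, s)"
    using * by auto
  then show ?case
    unfolding history_Suc IH a_def[symmetric] by (simp only: fun_upd_other not_False_eq_True)
qed

lemma next_pull_fun_upd:
  assumes "next_pull \<pi> t (past \<pi> t (u, off, on)) = i"
  shows "past \<pi> t (u, off, on(i := z)) = past \<pi> t (u, off, on)"
  using assms by (cases i) (auto simp: past_def next_pull_def intro!: history_fun_upd)

text \<open>
  The event that entry \<open>i\<close> is the one revealed in round \<open>t\<close> does not depend on the value of
  that entry.
\<close>

lemma next_pull_fun_upd_iff:
  "next_pull \<pi> t (past \<pi> t (u, off, on(i := z))) = i \<longleftrightarrow> next_pull \<pi> t (past \<pi> t (u, off, on)) = i"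
  using next_pull_fun_upd[of \<pi> t u off on i z] next_pull_fun_upd[of \<pi> t u off "on(i := z)" i "on i"]
  by auto

lemma sets_online_law [measurable_cong, simp]: "sets (online_law \<theta> k) = sets (borel \<Otimes>\<^sub>M borel)"
  by (simp add: online_law_def normal2_def flip: borel_prod)

lemma space_online_law [simp]: "space (online_law \<theta> k) = UNIV"
  by (simp add: online_law_def normal2_def)

lemma sets_offline_law [measurable_cong, simp]: "sets (offline_law \<theta> k) = sets borel"
  by (simp add: offline_law_def)

lemma sets_bandit_space [measurable_cong]:
  "sets (bandit_space N \<theta> \<pi>) = sets (seed \<pi> \<Otimes>\<^sub>M (\<Pi>\<^sub>M i\<in>offline_index N. borel) \<Otimes>\<^sub>M
     (\<Pi>\<^sub>M i\<in>UNIV. borel \<Otimes>\<^sub>M borel))"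
  unfolding bandit_space_def
  by (intro sets_pair_measure_cong sets_PiM_cong refl) (auto split: prod.split)

lemma choice_measurable [measurable]:
  assumes "is_policy N \<pi>"
  shows "choice \<pi> t \<in> past_algebra N \<pi> t \<rightarrow>\<^sub>M count_space UNIV"
  using assms unfolding is_policy_def past_algebra_def choice_def by auto

lemma pulls_measurable [measurable]:
  "(\<lambda>h. pulls h t (k::'k::finite)) \<in> (\<Pi>\<^sub>M i\<in>{..<t}. count_space UNIV \<Otimes>\<^sub>M borel \<Otimes>\<^sub>M borel) \<rightarrow>\<^sub>M count_space UNIV"
proof -
  have "pulls h t k = (\<Sum>i<t. if fst (h i) = k then 1 else 0)" for h :: "'k history"
  proof -
    have "{i. i < t \<and> fst (h i) = k} = {i \<in> {..<t}. fst (h i) = k}" by auto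
    then show ?thesis by (simp add: pulls_def sum.If_cases Int_def)
  qed
  then show ?thesis by simp
qed

text \<open>
  The index set need only be countable as a set: the arms form a type of class \<open>finite\<close>, which is
  not of class \<open>countable\<close>.
\<close>

lemma measurable_discrete_argument:
  assumes g: "g \<in> M \<rightarrow>\<^sub>M count_space UNIV" and f: "\<And>i::'i. (\<lambda>x. f i x) \<in> M \<rightarrow>\<^sub>M M'"
    and "countable (UNIV :: 'i set)"
  shows "(\<lambda>x. f (g x) x) \<in> M \<rightarrow>\<^sub>M M'"
  by (rule measurable_compose_countable'[OF f g assms(3)])

lemma next_pull_measurable [measurable]:
  fixes \<pi> :: "('u, 'k::finite) policy"
  assumes pol [measurable]: "is_policy N \<pi>"
  shows "next_pull \<pi> t \<in> past_algebra N \<pi> t \<rightarrow>\<^sub>M count_space UNIV"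
proof -
  have [measurable]: "(\<lambda>p. pulls (snd (snd p)) t k) \<in> past_algebra N \<pi> t \<rightarrow>\<^sub>M count_space UNIV" for k
    unfolding past_algebra_def by measurable
  have "(\<lambda>p. pulls (snd (snd p)) t (choice \<pi> t p)) \<in> past_algebra N \<pi> t \<rightarrow>\<^sub>M count_space UNIV"
    by (rule measurable_discrete_argument) (use pol in \<open>auto intro: countable_finite\<close>)
  then have "next_pull \<pi> t \<in> past_algebra N \<pi> t \<rightarrow>\<^sub>M count_space UNIV \<Otimes>\<^sub>M count_space UNIV"
    unfolding next_pull_def using pol by measurable
  then show ?thesis
    by (simp add: pair_measure_countable countable_finite)
qed

lemma extend_past_measurable [measurable]:
  assumes "is_policy N \<pi>"
  shows "(\<lambda>(p, z). extend_past \<pi> t p z) \<in> past_algebra N \<pi> t \<Otimes>\<^sub>M (borel \<Otimes>\<^sub>M borel) \<rightarrow>\<^sub>M past_algebra N \<pi> (Suc t)"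
proof -
  have [measurable]: "choice \<pi> t \<in> past_algebra N \<pi> t \<rightarrow>\<^sub>M count_space UNIV"
    using assms by simp
  have [measurable]: "(\<lambda>x. snd (snd (fst x))) \<in> past_algebra N \<pi> t \<Otimes>\<^sub>M (borel \<Otimes>\<^sub>M borel :: (real \<times> real) measure) \<rightarrow>\<^sub>M
      (\<Pi>\<^sub>M i\<in>{..<t}. count_space UNIV \<Otimes>\<^sub>M borel \<Otimes>\<^sub>M borel)"
    "(\<lambda>x. fst (fst x)) \<in> past_algebra N \<pi> t \<Otimes>\<^sub>M (borel \<Otimes>\<^sub>M borel :: (real \<times> real) measure) \<rightarrow>\<^sub>M seed \<pi>"
    "(\<lambda>x. fst (snd (fst x))) \<in> past_algebra N \<pi> t \<Otimes>\<^sub>M (borel \<Otimes>\<^sub>M borel :: (real \<times> real) measure) \<rightarrow>\<^sub>M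
      (\<Pi>\<^sub>M i\<in>offline_index N. borel)"
    unfolding past_algebra_def by measurable
  have "(\<lambda>x. (snd (snd (fst x)))(t := (choice \<pi> t (fst x), snd x))) \<in>
      past_algebra N \<pi> t \<Otimes>\<^sub>M (borel \<Otimes>\<^sub>M borel) \<rightarrow>\<^sub>M
      (\<Pi>\<^sub>M i\<in>insert t {..<t}. count_space UNIV \<Otimes>\<^sub>M borel \<Otimes>\<^sub>M borel)"
    by measurable
  then have [measurable]: "(\<lambda>x. (snd (snd (fst x)))(t := (choice \<pi> t (fst x), snd x))) \<in>
      past_algebra N \<pi> t \<Otimes>\<^sub>M (borel \<Otimes>\<^sub>M borel) \<rightarrow>\<^sub>M
      (\<Pi>\<^sub>M i\<in>{..<Suc t}. count_space UNIV \<Otimes>\<^sub>M borel \<Otimes>\<^sub>M borel)"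
    by (simp only: lessThan_Suc)
  show ?thesis
    unfolding extend_past_def case_prod_beta past_algebra_def[of N \<pi> "Suc t"] by measurable
qed

lemma past_measurable [measurable]:
  fixes \<pi> :: "('u, 'k::finite) policy"
  assumes pol: "is_policy N \<pi>"
  shows "past \<pi> t \<in> bandit_space N \<theta> \<pi> \<rightarrow>\<^sub>M past_algebra N \<pi> t"
proof (induction t)
  case 0
  have "(\<lambda>_. \<lambda>_. undefined) \<in> bandit_space N \<theta> \<pi> \<rightarrow>\<^sub>M
      (\<Pi>\<^sub>M i\<in>{..<0::nat}. count_space (UNIV :: 'k set) \<Otimes>\<^sub>M (borel \<Otimes>\<^sub>M borel :: (real \<times> real) measure))"
    by (rule measurable_const) (simp add: space_PiM)
  then show ?case
    unfolding past_0 past_algebra_def by measurable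
next
  case (Suc t)
  note [measurable] = Suc extend_past_measurable[OF pol] next_pull_measurable[OF pol]
  have comp: "(\<lambda>\<omega>. snd (snd \<omega>) i) \<in> bandit_space N \<theta> \<pi> \<rightarrow>\<^sub>M borel \<Otimes>\<^sub>M borel" for i
    by measurable
  have "(\<lambda>\<omega>. snd (snd \<omega>) (next_pull \<pi> t (past \<pi> t \<omega>))) \<in> bandit_space N \<theta> \<pi> \<rightarrow>\<^sub>M borel \<Otimes>\<^sub>M borel"
    by (rule measurable_discrete_argument[of "\<lambda>\<omega>. next_pull \<pi> t (past \<pi> t \<omega>)" _ "\<lambda>i \<omega>. snd (snd \<omega>) i"])
      (auto intro: comp)
  then have "(\<lambda>\<omega>. (\<lambda>(p, z). extend_past \<pi> t p z) (past \<pi> t \<omega>, snd (snd \<omega>) (next_pull \<pi> t (past \<pi> t \<omega>))))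
      \<in> bandit_space N \<theta> \<pi> \<rightarrow>\<^sub>M past_algebra N \<pi> (Suc t)"
    by measurable
  then show ?case
    unfolding past_Suc[abs_def] by simp
qed

section \<open>Newly revealed rewards\<close>

lemma prob_space_offline_law:
  assumes "bandit_instance \<theta>"
  shows "prob_space (offline_law \<theta> k)"
  using assms by (auto simp: offline_law_def bandit_instance_def intro: prob_space_normal_density)

lemma bandit_space_factors:
  assumes "is_policy N \<pi>" "bandit_instance \<theta>"
  shows "prob_space (seed \<pi>)"
    and "prob_space (\<Pi>\<^sub>M (k, i)\<in>offline_index N. offline_law \<theta> k)"
    and "prob_space (\<Pi>\<^sub>M (k, s)\<in>UNIV. online_law \<theta> k)"
  using assms prob_space_offline_law prob_space_online_law
  by (auto simp: is_policy_def intro!: prob_space_PiM)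

lemma prob_space_bandit_space:
  assumes "is_policy N \<pi>" "bandit_instance \<theta>"
  shows "prob_space (bandit_space N \<theta> \<pi>)"
  unfolding bandit_space_def
  by (intro prob_space_pair bandit_space_factors[OF assms])

lemma nn_integral_bandit_space:
  assumes "is_policy N \<pi>" "bandit_instance \<theta>" and [measurable]: "F \<in> borel_measurable (bandit_space N \<theta> \<pi>)"
  shows "(\<integral>\<^sup>+\<omega>. F \<omega> \<partial>bandit_space N \<theta> \<pi>) =
    (\<integral>\<^sup>+u. \<integral>\<^sup>+off. \<integral>\<^sup>+on. F (u, off, on) \<partial>(\<Pi>\<^sub>M (k, s)\<in>UNIV. online_law \<theta> k)
      \<partial>(\<Pi>\<^sub>M (k, i)\<in>offline_index N. offline_law \<theta> k) \<partial>seed \<pi>)"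
proof -
  define S where "S = seed \<pi>"
  define R where "R = (\<Pi>\<^sub>M (k, i)\<in>offline_index N. offline_law \<theta> k)"
  define P where "P = (\<Pi>\<^sub>M (k, s)\<in>(UNIV :: ('a \<times> nat) set). online_law \<theta> k)"
  interpret S: prob_space S using bandit_space_factors[OF assms(1,2)] by (simp add: S_def)
  interpret R: prob_space R using bandit_space_factors[OF assms(1,2)] by (simp add: R_def)
  interpret P: prob_space P using bandit_space_factors[OF assms(1,2)] by (simp add: P_def)
  interpret RP: prob_space "R \<Otimes>\<^sub>M P" by (intro prob_space_pair) unfold_locales
  have eq: "bandit_space N \<theta> \<pi> = S \<Otimes>\<^sub>M R \<Otimes>\<^sub>M P"
    by (simp add: bandit_space_def S_def R_def P_def)
  have [measurable]: "F \<in> borel_measurable (S \<Otimes>\<^sub>M R \<Otimes>\<^sub>M P)"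
    using assms(3) eq by simp
  have "(\<integral>\<^sup>+\<omega>. F \<omega> \<partial>(S \<Otimes>\<^sub>M R \<Otimes>\<^sub>M P)) = (\<integral>\<^sup>+u. \<integral>\<^sup>+x. F (u, x) \<partial>(R \<Otimes>\<^sub>M P) \<partial>S)"
    by (rule RP.nn_integral_fst[symmetric]) measurable
  also have "\<dots> = (\<integral>\<^sup>+u. \<integral>\<^sup>+off. \<integral>\<^sup>+on. F (u, off, on) \<partial>P \<partial>R \<partial>S)"
  proof (intro nn_integral_cong)
    fix u assume [measurable]: "u \<in> space S"
    show "(\<integral>\<^sup>+x. F (u, x) \<partial>(R \<Otimes>\<^sub>M P)) = (\<integral>\<^sup>+off. \<integral>\<^sup>+on. F (u, off, on) \<partial>P \<partial>R)"
      by (rule P.nn_integral_fst[symmetric, of "\<lambda>x. F (u, x)"]) measurable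
  qed
  finally show ?thesis
    by (simp only: eq S_def[symmetric] R_def[symmetric] P_def[symmetric])
qed

text \<open>
  Overwriting one coordinate of a product measure by an independent draw from its marginal
  preserves the measure, even if the coordinate was there already.
\<close>

lemma nn_integral_PiM_resample:
  assumes prob: "\<And>i. prob_space (Q i)" and [measurable]: "G \<in> borel_measurable (\<Pi>\<^sub>M i\<in>UNIV. Q i)"
  shows "(\<integral>\<^sup>+x. G x \<partial>(\<Pi>\<^sub>M i\<in>UNIV. Q i)) = (\<integral>\<^sup>+x. \<integral>\<^sup>+z. G (x(i := z)) \<partial>Q i \<partial>(\<Pi>\<^sub>M i\<in>UNIV. Q i))"
proof -
  let ?P = "\<Pi>\<^sub>M i\<in>UNIV. Q i"
  interpret P: prob_space ?P by (intro prob_space_PiM prob)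
  interpret Q: prob_space "Q i" by (rule prob)
  interpret pair_sigma_finite "Q i" ?P ..
  have [measurable]: "(\<lambda>(x, z). x(i := z)) \<in> ?P \<Otimes>\<^sub>M Q i \<rightarrow>\<^sub>M ?P"
    using measurable_add_dim[of i UNIV Q] by (simp add: insert_absorb)
  have "(\<lambda>y. (\<lambda>(x, z). x(i := z)) (snd y, fst y)) \<in> Q i \<Otimes>\<^sub>M ?P \<rightarrow>\<^sub>M ?P"
    by measurable
  then have upd [measurable]: "(\<lambda>(z, x). x(i := z)) \<in> Q i \<Otimes>\<^sub>M ?P \<rightarrow>\<^sub>M ?P"
    by (simp add: case_prod_beta')
  have "?P = distr (Q i \<Otimes>\<^sub>M ?P) ?P (\<lambda>(z, x). x(i := z))"
    using distr_pair_PiM_eq_PiM[of UNIV Q i] prob by (simp add: insert_absorb)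
  then have "(\<integral>\<^sup>+x. G x \<partial>?P) = (\<integral>\<^sup>+x. G x \<partial>distr (Q i \<Otimes>\<^sub>M ?P) ?P (\<lambda>(z, x). x(i := z)))"
    by simp
  also have "\<dots> = (\<integral>\<^sup>+y. G ((snd y)(i := fst y)) \<partial>(Q i \<Otimes>\<^sub>M ?P))"
    by (subst nn_integral_distr) (auto simp: case_prod_beta)
  also have "\<dots> = (\<integral>\<^sup>+x. \<integral>\<^sup>+z. G (x(i := z)) \<partial>Q i \<partial>?P)"
    by (subst nn_integral_snd[symmetric]) (auto simp: case_prod_beta)
  finally show ?thesis .
qed

lemma nn_integral_resample:
  fixes i :: "'k::finite \<times> nat"
  assumes pol: "is_policy N \<pi>" and inst: "bandit_instance \<theta>"
    and F [measurable]: "F \<in> borel_measurable (bandit_space N \<theta> \<pi>)"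
  shows "(\<integral>\<^sup>+\<omega>. F \<omega> \<partial>bandit_space N \<theta> \<pi>) =
    (\<integral>\<^sup>+\<omega>. \<integral>\<^sup>+z. F (fst \<omega>, fst (snd \<omega>), (snd (snd \<omega>))(i := z)) \<partial>online_law \<theta> (fst i)
      \<partial>bandit_space N \<theta> \<pi>)"
proof -
  let ?Q = "\<lambda>i :: 'k \<times> nat. online_law \<theta> (fst i)"
  have Q: "(\<Pi>\<^sub>M (k, s)\<in>(UNIV :: ('k \<times> nat) set). online_law \<theta> k) = (\<Pi>\<^sub>M i\<in>UNIV. ?Q i)"
    by (simp add: case_prod_beta')
  interpret Q: prob_space "?Q j" for j by (rule prob_space_online_law[OF inst])
  have upd: "(\<lambda>y. (fst (fst y), fst (snd (fst y)), (snd (snd (fst y)))(i := snd y)))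
      \<in> bandit_space N \<theta> \<pi> \<Otimes>\<^sub>M ?Q i \<rightarrow>\<^sub>M bandit_space N \<theta> \<pi>"
  proof -
    have "(\<lambda>y. (snd (snd (fst y)))(i := snd y)) \<in> bandit_space N \<theta> \<pi> \<Otimes>\<^sub>M ?Q i \<rightarrow>\<^sub>M
        (\<Pi>\<^sub>M i\<in>UNIV. borel \<Otimes>\<^sub>M borel)"
      by (rule measurable_PiM_single') (auto simp: space_PiM space_pair_measure fun_upd_def)
    then show ?thesis by measurable
  qed
  have F2: "(\<lambda>(\<omega>, z). F (fst \<omega>, fst (snd \<omega>), (snd (snd \<omega>))(i := z))) \<in>
      borel_measurable (bandit_space N \<theta> \<pi> \<Otimes>\<^sub>M ?Q i)"
    using measurable_compose[OF upd F] by (simp add: case_prod_beta)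
  have meas: "(\<lambda>\<omega>. \<integral>\<^sup>+z. F (fst \<omega>, fst (snd \<omega>), (snd (snd \<omega>))(i := z)) \<partial>?Q i)
      \<in> borel_measurable (bandit_space N \<theta> \<pi>)"
    by (rule Q.borel_measurable_nn_integral[OF F2])
  have inner: "(\<integral>\<^sup>+on. F (u, off, on) \<partial>(\<Pi>\<^sub>M i\<in>UNIV. ?Q i)) =
      (\<integral>\<^sup>+on. \<integral>\<^sup>+z. F (u, off, on(i := z)) \<partial>?Q i \<partial>(\<Pi>\<^sub>M i\<in>UNIV. ?Q i))"
    if "u \<in> space (seed \<pi>)" "off \<in> space (\<Pi>\<^sub>M (k, i)\<in>offline_index N. offline_law \<theta> k)" for u off
  proof (rule nn_integral_PiM_resample)
    have "F \<in> borel_measurable (seed \<pi> \<Otimes>\<^sub>M (\<Pi>\<^sub>M (k, i)\<in>offline_index N. offline_law \<theta> k) \<Otimes>\<^sub>M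
        (\<Pi>\<^sub>M i\<in>UNIV. ?Q i))"
      using F by (simp add: bandit_space_def Q)
    with that show "(\<lambda>on. F (u, off, on)) \<in> borel_measurable (\<Pi>\<^sub>M i\<in>UNIV. ?Q i)"
      by measurable
  qed (rule Q.prob_space_axioms)
  have "(\<integral>\<^sup>+\<omega>. F \<omega> \<partial>bandit_space N \<theta> \<pi>) = (\<integral>\<^sup>+u. \<integral>\<^sup>+off. \<integral>\<^sup>+on. F (u, off, on)
      \<partial>(\<Pi>\<^sub>M i\<in>UNIV. ?Q i) \<partial>(\<Pi>\<^sub>M (k, i)\<in>offline_index N. offline_law \<theta> k) \<partial>seed \<pi>)"
    unfolding nn_integral_bandit_space[OF pol inst F] Q ..
  also have "\<dots> = (\<integral>\<^sup>+u. \<integral>\<^sup>+off. \<integral>\<^sup>+on. \<integral>\<^sup>+z. F (u, off, on(i := z)) \<partial>?Q i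
      \<partial>(\<Pi>\<^sub>M i\<in>UNIV. ?Q i) \<partial>(\<Pi>\<^sub>M (k, i)\<in>offline_index N. offline_law \<theta> k) \<partial>seed \<pi>)"
    by (intro nn_integral_cong inner)
  also have "\<dots> = (\<integral>\<^sup>+\<omega>. \<integral>\<^sup>+z. F (fst \<omega>, fst (snd \<omega>), (snd (snd \<omega>))(i := z)) \<partial>?Q i \<partial>bandit_space N \<theta> \<pi>)"
    using nn_integral_bandit_space[OF pol inst meas] by (simp add: Q)
  finally show ?thesis .
qed

text \<open>
  Conditionally on the past, the observation of round \<open>t\<close> is distributed according to the law of
  the chosen arm. To see this, split according to which entry \<open>i\<close> of the table is revealed
  and resample that entry; neither the past nor the event that \<open>i\<close> is next
  changes, so the revealed value becomes an independent draw.
\<close>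

lemma nn_integral_fresh_observation:
  fixes \<pi> :: "('u, 'k::finite) policy"
  assumes pol: "is_policy N \<pi>" and inst: "bandit_instance \<theta>"
    and f: "f \<in> borel_measurable (past_algebra N \<pi> t \<Otimes>\<^sub>M (borel \<Otimes>\<^sub>M borel))"
  shows "(\<integral>\<^sup>+\<omega>. f (past \<pi> t \<omega>, snd (snd \<omega>) (next_pull \<pi> t (past \<pi> t \<omega>))) \<partial>bandit_space N \<theta> \<pi>) =
    (\<integral>\<^sup>+\<omega>. \<integral>\<^sup>+z. f (past \<pi> t \<omega>, z) \<partial>online_law \<theta> (arm \<pi> t \<omega>) \<partial>bandit_space N \<theta> \<pi>)"
proof -
  let ?M = "bandit_space N \<theta> \<pi>"
  \<comment> \<open>Before round \<open>t\<close> an arm has been pulled at most \<open>t\<close> times, so the split is finite.\<close>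
  let ?I = "UNIV \<times> {..t} :: ('k \<times> nat) set"
  let ?next = "\<lambda>\<omega>. next_pull \<pi> t (past \<pi> t \<omega>)"
  note [measurable] = past_measurable[OF pol] next_pull_measurable[OF pol] f
  have next_in: "?next \<omega> \<in> ?I" for \<omega>
    by (auto simp: next_pull_def pulls_le)
  have split: "g (?next \<omega>) = (\<Sum>i\<in>?I. indicator {i} (?next \<omega>) * g i)" for g :: "_ \<Rightarrow> ennreal" and \<omega>
    using next_in[of \<omega>] by (simp add: indicator_def sum.delta if_distrib[of "\<lambda>x. x * _"] cong: if_cong)
  have law: "arm \<pi> t \<omega> = fst (?next \<omega>)" for \<omega>
    by (simp add: arm_eq_choice next_pull_def)
  have inner [measurable]: "(\<lambda>\<omega>. \<integral>\<^sup>+z. f (past \<pi> t \<omega>, z) \<partial>online_law \<theta> k) \<in> borel_measurable ?M" for k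
  proof -
    interpret prob_space "online_law \<theta> k" by (rule prob_space_online_law[OF inst])
    show ?thesis by measurable
  qed
  have "(\<integral>\<^sup>+\<omega>. f (past \<pi> t \<omega>, snd (snd \<omega>) (?next \<omega>)) \<partial>?M) =
      (\<integral>\<^sup>+\<omega>. (\<Sum>i\<in>?I. indicator {i} (?next \<omega>) * f (past \<pi> t \<omega>, snd (snd \<omega>) i)) \<partial>?M)"
    by (subst split) simp
  also have "\<dots> = (\<Sum>i\<in>?I. \<integral>\<^sup>+\<omega>. indicator {i} (?next \<omega>) * f (past \<pi> t \<omega>, snd (snd \<omega>) i) \<partial>?M)"
    by (rule nn_integral_sum) measurable
  also have "\<dots> = (\<Sum>i\<in>?I. \<integral>\<^sup>+\<omega>. indicator {i} (?next \<omega>) *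
      (\<integral>\<^sup>+z. f (past \<pi> t \<omega>, z) \<partial>online_law \<theta> (fst i)) \<partial>?M)"
  proof (rule sum.cong[OF refl])
    fix i :: "'k \<times> nat"
    have meas: "(\<lambda>\<omega>. indicator {i} (?next \<omega>) * f (past \<pi> t \<omega>, snd (snd \<omega>) i)) \<in> borel_measurable ?M"
      by measurable
    have "(\<integral>\<^sup>+\<omega>. indicator {i} (?next \<omega>) * f (past \<pi> t \<omega>, snd (snd \<omega>) i) \<partial>?M) =
        (\<integral>\<^sup>+\<omega>. \<integral>\<^sup>+z. indicator {i} (?next (fst \<omega>, fst (snd \<omega>), (snd (snd \<omega>))(i := z))) *
          f (past \<pi> t (fst \<omega>, fst (snd \<omega>), (snd (snd \<omega>))(i := z)), z) \<partial>online_law \<theta> (fst i) \<partial>?M)"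
      by (subst nn_integral_resample[OF pol inst meas, where i = i]) simp
    also have "\<dots> = (\<integral>\<^sup>+\<omega>. \<integral>\<^sup>+z. indicator {i} (?next \<omega>) * f (past \<pi> t \<omega>, z) \<partial>online_law \<theta> (fst i) \<partial>?M)"
      by (intro nn_integral_cong)
        (auto simp: indicator_def next_pull_fun_upd_iff next_pull_fun_upd[OF refl])
    also have "\<dots> = (\<integral>\<^sup>+\<omega>. indicator {i} (?next \<omega>) *
      (\<integral>\<^sup>+z. f (past \<pi> t \<omega>, z) \<partial>online_law \<theta> (fst i)) \<partial>?M)"
    proof (intro nn_integral_cong)
      fix \<omega> assume [measurable]: "\<omega> \<in> space ?M"
      show "(\<integral>\<^sup>+z. indicator {i} (?next \<omega>) * f (past \<pi> t \<omega>, z) \<partial>online_law \<theta> (fst i)) =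
          indicator {i} (?next \<omega>) * (\<integral>\<^sup>+z. f (past \<pi> t \<omega>, z) \<partial>online_law \<theta> (fst i))"
        by (rule nn_integral_cmult) measurable
    qed
    finally show "(\<integral>\<^sup>+\<omega>. indicator {i} (?next \<omega>) * f (past \<pi> t \<omega>, snd (snd \<omega>) i) \<partial>?M) =
      (\<integral>\<^sup>+\<omega>. indicator {i} (?next \<omega>) *
        (\<integral>\<^sup>+z. f (past \<pi> t \<omega>, z) \<partial>online_law \<theta> (fst i)) \<partial>?M)" .
  qed
  also have "\<dots> = (\<integral>\<^sup>+\<omega>. (\<Sum>i\<in>?I. indicator {i} (?next \<omega>) *
      (\<integral>\<^sup>+z. f (past \<pi> t \<omega>, z) \<partial>online_law \<theta> (fst i))) \<partial>?M)"
    by (rule nn_integral_sum[symmetric]) measurable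
  also have "\<dots> = (\<integral>\<^sup>+\<omega>. \<integral>\<^sup>+z. f (past \<pi> t \<omega>, z) \<partial>online_law \<theta> (arm \<pi> t \<omega>) \<partial>?M)"
    by (subst split[symmetric]) (simp add: law)
  finally show ?thesis .
qed

section \<open>Change of instance\<close>

definition likelihood_ratio ::
  "('k \<Rightarrow> real \<times> real \<Rightarrow> real) \<Rightarrow> nat \<Rightarrow> 'u \<times> 'k offline \<times> 'k history \<Rightarrow> real" where
  "likelihood_ratio r t p = (\<Prod>i<t. r (fst (snd (snd p) i)) (snd (snd (snd p) i)))"

lemma likelihood_ratio_0 [simp]: "likelihood_ratio r 0 p = 1"
  by (simp add: likelihood_ratio_def)

lemma likelihood_ratio_extend_past:
  "likelihood_ratio r (Suc t) (extend_past \<pi> t p z) = likelihood_ratio r t p * r (choice \<pi> t p) z"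
  by (simp add: likelihood_ratio_def extend_past_def)

lemma likelihood_ratio_measurable [measurable]:
  fixes \<pi> :: "('u, 'k::finite) policy"
  assumes r: "\<And>k. r k \<in> borel_measurable (borel \<Otimes>\<^sub>M borel)"
  shows "likelihood_ratio r t \<in> borel_measurable (past_algebra N \<pi> t)"
proof -
  have "(\<lambda>p. r (fst (snd (snd p) i)) (snd (snd (snd p) i))) \<in> borel_measurable (past_algebra N \<pi> t)"
    if "i < t" for i
  proof (rule measurable_discrete_argument[of "\<lambda>p. fst (snd (snd p) i)" _ "\<lambda>k p. r k (snd (snd (snd p) i))"])
    note [measurable] = r
    have comp: "(\<lambda>h. h i) \<in> (\<Pi>\<^sub>M i\<in>{..<t}. count_space UNIV \<Otimes>\<^sub>M borel \<Otimes>\<^sub>M borel) \<rightarrow>\<^sub>M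
        count_space (UNIV :: 'k set) \<Otimes>\<^sub>M (borel \<Otimes>\<^sub>M borel :: (real \<times> real) measure)"
      using that by (intro measurable_component_singleton) simp
    have "(\<lambda>p. snd (snd p)) \<in> past_algebra N \<pi> t \<rightarrow>\<^sub>M
        (\<Pi>\<^sub>M i\<in>{..<t}. count_space UNIV \<Otimes>\<^sub>M borel \<Otimes>\<^sub>M borel)"
      unfolding past_algebra_def by measurable
    from measurable_compose[OF this comp]
    have [measurable]: "(\<lambda>p. snd (snd p) i) \<in> past_algebra N \<pi> t \<rightarrow>\<^sub>M count_space UNIV \<Otimes>\<^sub>M borel \<Otimes>\<^sub>M borel" .
    show "(\<lambda>p. fst (snd (snd p) i)) \<in> past_algebra N \<pi> t \<rightarrow>\<^sub>M count_space UNIV"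
      "\<And>k. (\<lambda>p. r k (snd (snd (snd p) i))) \<in> borel_measurable (past_algebra N \<pi> t)"
      by measurable
  qed (simp add: countable_finite)
  then show ?thesis
    unfolding likelihood_ratio_def by (intro borel_measurable_prod) simp
qed

text \<open>
  Wald's likelihood ratio identity. At time 0 the laws agree, because the offline data depend on
  the instance only through the surrogate parameters. In each round the decision is the
  same function of the past under both instances and cancels, so the only new factor is the density
  ratio of the fresh observation.
\<close>

lemma change_of_measure:
  fixes \<pi> :: "('u, 'k::finite) policy"
  assumes pol: "is_policy N \<pi>" and inst: "bandit_instance \<theta>" and inst': "bandit_instance \<theta>'"
    and surrogate: "smean \<theta>' = smean \<theta>" "ssd \<theta>' = ssd \<theta>"
    and r [measurable]: "\<And>k. r k \<in> borel_measurable (borel \<Otimes>\<^sub>M borel)" and r0: "\<And>k z. 0 \<le> r k z"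
    and online: "\<And>k. online_law \<theta>' k = density (online_law \<theta> k) (r k)"
    and g: "g \<in> borel_measurable (past_algebra N \<pi> t)"
  shows "(\<integral>\<^sup>+\<omega>. g (past \<pi> t \<omega>) \<partial>bandit_space N \<theta>' \<pi>) =
    (\<integral>\<^sup>+\<omega>. g (past \<pi> t \<omega>) * ennreal (likelihood_ratio r t (past \<pi> t \<omega>)) \<partial>bandit_space N \<theta> \<pi>)"
  using g
proof (induction t arbitrary: g)
  case 0
  have offline: "offline_law \<theta>' = offline_law \<theta>"
    by (simp add: fun_eq_iff offline_law_def surrogate)
  interpret P: prob_space "\<Pi>\<^sub>M (k, s)\<in>(UNIV :: ('k \<times> nat) set). online_law \<theta> k"
    by (rule bandit_space_factors[OF pol inst])
  interpret P': prob_space "\<Pi>\<^sub>M (k, s)\<in>(UNIV :: ('k \<times> nat) set). online_law \<theta>' k"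
    by (rule bandit_space_factors[OF pol inst'])
  have meas: "(\<lambda>\<omega>. g (past \<pi> 0 \<omega>)) \<in> borel_measurable (bandit_space N \<eta> \<pi>)" for \<eta>
    using past_measurable[OF pol] 0 by measurable
  have "(\<integral>\<^sup>+\<omega>. g (past \<pi> 0 \<omega>) \<partial>bandit_space N \<theta>' \<pi>) =
      (\<integral>\<^sup>+u. \<integral>\<^sup>+off. g (u, off, \<lambda>_. undefined) \<partial>(\<Pi>\<^sub>M (k, i)\<in>offline_index N. offline_law \<theta> k) \<partial>seed \<pi>)"
    unfolding nn_integral_bandit_space[OF pol inst' meas] by (simp add: past_0 offline P'.emeasure_space_1)
  also have "\<dots> = (\<integral>\<^sup>+\<omega>. g (past \<pi> 0 \<omega>) \<partial>bandit_space N \<theta> \<pi>)"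
    unfolding nn_integral_bandit_space[OF pol inst meas] by (simp add: past_0 P.emeasure_space_1)
  finally show ?case by simp
next
  case (Suc t)
  note [measurable] = past_measurable[OF pol] next_pull_measurable[OF pol] choice_measurable[OF pol]
    extend_past_measurable[OF pol] Suc.prems
  have arms: "countable (UNIV :: 'k set)"
    by (simp add: countable_finite)
  define f where "f = (\<lambda>(p, z). g (extend_past \<pi> t p z))"
  have [measurable]: "f \<in> borel_measurable (past_algebra N \<pi> t \<Otimes>\<^sub>M (borel \<Otimes>\<^sub>M borel))"
    unfolding f_def case_prod_beta by measurable
  define f\<^sub>r where "f\<^sub>r = (\<lambda>(p, z). f (p, z) * ennreal (likelihood_ratio r t p * r (choice \<pi> t p) z))"
  have r_choice: "(\<lambda>x. r (choice \<pi> t (fst x)) (snd x)) \<in>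
      borel_measurable (past_algebra N \<pi> t \<Otimes>\<^sub>M (borel \<Otimes>\<^sub>M borel))"
    by (rule measurable_discrete_argument[OF _ _ arms, where f = "\<lambda>k x. r k (snd x)"]) measurable
  have [measurable]: "f\<^sub>r \<in> borel_measurable (past_algebra N \<pi> t \<Otimes>\<^sub>M (borel \<Otimes>\<^sub>M borel))"
    using r_choice unfolding f\<^sub>r_def case_prod_beta by measurable
  have "(\<lambda>p. \<integral>\<^sup>+z. f (p, z) \<partial>online_law \<theta>' k) \<in> borel_measurable (past_algebra N \<pi> t)" for k
  proof -
    interpret prob_space "online_law \<theta>' k" by (rule prob_space_online_law[OF inst'])
    show ?thesis by measurable
  qed
  then have G: "(\<lambda>p. \<integral>\<^sup>+z. f (p, z) \<partial>online_law \<theta>' (choice \<pi> t p)) \<in> borel_measurable (past_algebra N \<pi> t)"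
    by (rule measurable_discrete_argument[OF choice_measurable[OF pol] _ arms,
          where f = "\<lambda>k p. \<integral>\<^sup>+z. f (p, z) \<partial>online_law \<theta>' k"])
  have lr_nonneg: "0 \<le> likelihood_ratio r t p" for p :: "'u \<times> 'k offline \<times> 'k history"
    by (simp add: likelihood_ratio_def prod_nonneg r0)
  have "(\<integral>\<^sup>+\<omega>. g (past \<pi> (Suc t) \<omega>) \<partial>bandit_space N \<theta>' \<pi>) =
      (\<integral>\<^sup>+\<omega>. f (past \<pi> t \<omega>, snd (snd \<omega>) (next_pull \<pi> t (past \<pi> t \<omega>))) \<partial>bandit_space N \<theta>' \<pi>)"
    by (simp add: past_Suc f_def)
  also have "\<dots> = (\<integral>\<^sup>+\<omega>. \<integral>\<^sup>+z. f (past \<pi> t \<omega>, z) \<partial>online_law \<theta>' (choice \<pi> t (past \<pi> t \<omega>))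
      \<partial>bandit_space N \<theta>' \<pi>)"
    by (subst nn_integral_fresh_observation[OF pol inst']) (simp_all add: arm_eq_choice)
  also have "\<dots> = (\<integral>\<^sup>+\<omega>. (\<integral>\<^sup>+z. f (past \<pi> t \<omega>, z) \<partial>online_law \<theta>' (choice \<pi> t (past \<pi> t \<omega>))) *
      ennreal (likelihood_ratio r t (past \<pi> t \<omega>)) \<partial>bandit_space N \<theta> \<pi>)"
    by (rule Suc.IH[OF G])
  also have "\<dots> = (\<integral>\<^sup>+\<omega>. \<integral>\<^sup>+z. f\<^sub>r (past \<pi> t \<omega>, z) \<partial>online_law \<theta> (arm \<pi> t \<omega>) \<partial>bandit_space N \<theta> \<pi>)"
  proof (intro nn_integral_cong)
    fix \<omega> assume \<omega>: "\<omega> \<in> space (bandit_space N \<theta> \<pi>)"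
    define p where "p = past \<pi> t \<omega>"
    have [measurable]: "p \<in> space (past_algebra N \<pi> t)"
      using measurable_space[OF past_measurable[OF pol] \<omega>] by (simp add: p_def)
    have "(\<integral>\<^sup>+z. f (p, z) \<partial>online_law \<theta>' (choice \<pi> t p)) * ennreal (likelihood_ratio r t p) =
        (\<integral>\<^sup>+z. ennreal (r (choice \<pi> t p) z) * f (p, z) \<partial>online_law \<theta> (choice \<pi> t p)) *
        ennreal (likelihood_ratio r t p)"
      unfolding online by (subst nn_integral_density) simp_all
    also have "\<dots> = (\<integral>\<^sup>+z. ennreal (r (choice \<pi> t p) z) * f (p, z) * ennreal (likelihood_ratio r t p)
        \<partial>online_law \<theta> (choice \<pi> t p))"
      by (rule nn_integral_multc[symmetric]) measurable
    also have "\<dots> = (\<integral>\<^sup>+z. f\<^sub>r (p, z) \<partial>online_law \<theta> (choice \<pi> t p))"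
      by (intro nn_integral_cong) (simp add: f\<^sub>r_def ennreal_mult lr_nonneg r0 ac_simps)
    finally show "(\<integral>\<^sup>+z. f (past \<pi> t \<omega>, z) \<partial>online_law \<theta>' (choice \<pi> t (past \<pi> t \<omega>))) *
        ennreal (likelihood_ratio r t (past \<pi> t \<omega>)) =
        (\<integral>\<^sup>+z. f\<^sub>r (past \<pi> t \<omega>, z) \<partial>online_law \<theta> (arm \<pi> t \<omega>))"
      by (simp add: p_def arm_eq_choice)
  qed
  also have "\<dots> = (\<integral>\<^sup>+\<omega>. f\<^sub>r (past \<pi> t \<omega>, snd (snd \<omega>) (next_pull \<pi> t (past \<pi> t \<omega>))) \<partial>bandit_space N \<theta> \<pi>)"
    by (subst nn_integral_fresh_observation[OF pol inst]) simp_all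
  also have "\<dots> = (\<integral>\<^sup>+\<omega>. g (past \<pi> (Suc t) \<omega>) *
      ennreal (likelihood_ratio r (Suc t) (past \<pi> (Suc t) \<omega>)) \<partial>bandit_space N \<theta> \<pi>)"
    by (simp add: past_Suc f_def f\<^sub>r_def likelihood_ratio_extend_past)
  finally show ?case .
qed

definition expected_pulls ::
  "('k::finite \<Rightarrow> nat) \<Rightarrow> 'k bandit \<Rightarrow> ('u, 'k) policy \<Rightarrow> nat \<Rightarrow> 'k \<Rightarrow> real" where
  "expected_pulls N \<theta> \<pi> T k =
    (\<Sum>t<T. measure (bandit_space N \<theta> \<pi>) {\<omega> \<in> space (bandit_space N \<theta> \<pi>). arm \<pi> t \<omega> = k})"

lemma arm_measurable [measurable]:
  assumes "is_policy N \<pi>"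
  shows "arm \<pi> t \<in> bandit_space N \<theta> \<pi> \<rightarrow>\<^sub>M count_space UNIV"
  unfolding arm_eq_choice[abs_def]
  using past_measurable[OF assms] choice_measurable[OF assms] by measurable

text \<open>
  The signed version of \<open>nn_integral_fresh_observation\<close> for the observations of a single arm,
  obtained from the positive and negative parts.
\<close>

lemma has_bochner_integral_fresh_observation:
  fixes \<pi> :: "('u, 'k::finite) policy"
  assumes pol: "is_policy N \<pi>" and inst: "bandit_instance \<theta>"
    and \<phi>: "integrable (online_law \<theta> k) \<phi>"
  shows "has_bochner_integral (bandit_space N \<theta> \<pi>)
    (\<lambda>\<omega>. indicator {k} (arm \<pi> t \<omega>) * \<phi> (snd (snd \<omega>) (next_pull \<pi> t (past \<pi> t \<omega>))))
    (measure (bandit_space N \<theta> \<pi>) {\<omega> \<in> space (bandit_space N \<theta> \<pi>). arm \<pi> t \<omega> = k} *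
      (\<integral>z. \<phi> z \<partial>online_law \<theta> k))"
proof -
  let ?M = "bandit_space N \<theta> \<pi>"
  let ?Z = "\<lambda>\<omega>. snd (snd \<omega>) (next_pull \<pi> t (past \<pi> t \<omega>))"
  let ?E = "{\<omega> \<in> space ?M. arm \<pi> t \<omega> = k}"
  interpret M: prob_space ?M by (rule prob_space_bandit_space[OF pol inst])
  note [measurable] = past_measurable[OF pol] next_pull_measurable[OF pol] choice_measurable[OF pol]
    arm_measurable[OF pol]
  have [measurable]: "\<phi> \<in> borel_measurable (borel \<Otimes>\<^sub>M borel)"
    using \<phi> by (auto cong: measurable_cong_sets)
  have comp: "(\<lambda>\<omega>. snd (snd \<omega>) i) \<in> ?M \<rightarrow>\<^sub>M borel \<Otimes>\<^sub>M borel" for i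
    by measurable
  have [measurable]: "?Z \<in> ?M \<rightarrow>\<^sub>M borel \<Otimes>\<^sub>M borel"
    by (rule measurable_discrete_argument[of "\<lambda>\<omega>. next_pull \<pi> t (past \<pi> t \<omega>)" _ "\<lambda>i \<omega>. snd (snd \<omega>) i"])
      (auto intro: comp)
  have nn: "(\<integral>\<^sup>+\<omega>. indicator {k} (arm \<pi> t \<omega>) * \<psi> (?Z \<omega>) \<partial>?M) =
      emeasure ?M ?E * (\<integral>\<^sup>+z. \<psi> z \<partial>online_law \<theta> k)"
    if [measurable]: "\<psi> \<in> borel_measurable (borel \<Otimes>\<^sub>M borel)" for \<psi> :: "real \<times> real \<Rightarrow> ennreal"
  proof -
    have "(\<integral>\<^sup>+\<omega>. indicator {k} (arm \<pi> t \<omega>) * \<psi> (?Z \<omega>) \<partial>?M) =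
        (\<integral>\<^sup>+\<omega>. \<integral>\<^sup>+z. indicator {k} (arm \<pi> t \<omega>) * \<psi> z \<partial>online_law \<theta> (arm \<pi> t \<omega>) \<partial>?M)"
      using nn_integral_fresh_observation[OF pol inst, of "\<lambda>(p, z). indicator {k} (choice \<pi> t p) * \<psi> z" t]
      by (simp add: arm_eq_choice)
    also have "\<dots> = (\<integral>\<^sup>+\<omega>. indicator ?E \<omega> * (\<integral>\<^sup>+z. \<psi> z \<partial>online_law \<theta> k) \<partial>?M)"
      by (intro nn_integral_cong) (auto simp: indicator_def)
    also have "\<dots> = emeasure ?M ?E * (\<integral>\<^sup>+z. \<psi> z \<partial>online_law \<theta> k)"
      by (subst nn_integral_multc) simp_all
    finally show ?thesis .
  qed
  have parts: "(\<integral>\<^sup>+\<omega>. ennreal (indicator {k} (arm \<pi> t \<omega>) * \<psi> (?Z \<omega>)) \<partial>?M) =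
      emeasure ?M ?E * (\<integral>\<^sup>+z. ennreal (\<psi> z) \<partial>online_law \<theta> k)"
    if [measurable]: "\<psi> \<in> borel_measurable (borel \<Otimes>\<^sub>M borel)" for \<psi> :: "real \<times> real \<Rightarrow> real"
    by (subst nn[symmetric], simp, intro nn_integral_cong) (simp add: indicator_def)
  have int: "integrable ?M (\<lambda>\<omega>. indicator {k} (arm \<pi> t \<omega>) * \<phi> (?Z \<omega>))"
  proof (rule integrableI_bounded)
    have fin: "(\<integral>\<^sup>+z. ennreal (norm (\<phi> z)) \<partial>online_law \<theta> k) < \<infinity>"
      using \<phi> unfolding integrable_iff_bounded by (rule conjunct2)
    have "(\<integral>\<^sup>+\<omega>. ennreal (norm (indicator {k} (arm \<pi> t \<omega>) * \<phi> (?Z \<omega>))) \<partial>?M) =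
        emeasure ?M ?E * (\<integral>\<^sup>+z. ennreal (norm (\<phi> z)) \<partial>online_law \<theta> k)"
      using parts[of "\<lambda>z. norm (\<phi> z)"] by (simp add: abs_mult indicator_def)
    also have "\<dots> < \<infinity>"
      using fin by (simp add: M.emeasure_eq_measure ennreal_mult_less_top)
    finally show "(\<integral>\<^sup>+\<omega>. ennreal (norm (indicator {k} (arm \<pi> t \<omega>) * \<phi> (?Z \<omega>))) \<partial>?M) < \<infinity>" .
  qed measurable
  have "(\<integral>\<omega>. indicator {k} (arm \<pi> t \<omega>) * \<phi> (?Z \<omega>) \<partial>?M) = measure ?M ?E * (\<integral>z. \<phi> z \<partial>online_law \<theta> k)"
    using parts[of \<phi>] parts[of "\<lambda>z. - \<phi> z"]
    by (simp add: real_lebesgue_integral_def[OF int] real_lebesgue_integral_def[OF \<phi>] enn2real_mult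
        measure_def right_diff_distrib)
  with int show ?thesis
    by (simp add: has_bochner_integral_iff)
qed

text \<open>
  The divergence decomposition: every pull of arm \<open>k\<close> contributes the relative entropy \<open>D k\<close> of a
  single observation, so the entropy of a trajectory is governed by the expected numbers of pulls
  and not by the number of rounds.
\<close>

lemma has_bochner_integral_neg_ln_likelihood_ratio:
  fixes \<pi> :: "('u, 'k::finite) policy"
  assumes pol: "is_policy N \<pi>" and inst: "bandit_instance \<theta>"
    and pos: "\<And>k z. 0 < r k z"
    and D: "\<And>k. has_bochner_integral (online_law \<theta> k) (\<lambda>z. - ln (r k z)) (D k)"
  shows "has_bochner_integral (bandit_space N \<theta> \<pi>) (\<lambda>\<omega>. - ln (likelihood_ratio r T (past \<pi> T \<omega>)))
    (\<Sum>k\<in>UNIV. expected_pulls N \<theta> \<pi> T k * D k)"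
proof (induction T)
  case 0
  show ?case by (simp add: expected_pulls_def has_bochner_integral_zero)
next
  case (Suc T)
  let ?M = "bandit_space N \<theta> \<pi>"
  let ?Z = "\<lambda>\<omega>. snd (snd \<omega>) (next_pull \<pi> T (past \<pi> T \<omega>))"
  have "has_bochner_integral ?M (\<lambda>\<omega>. indicator {k} (arm \<pi> T \<omega>) * - ln (r k (?Z \<omega>)))
      (measure ?M {\<omega> \<in> space ?M. arm \<pi> T \<omega> = k} * D k)" for k
    using has_bochner_integral_fresh_observation[OF pol inst integrable.intros[OF D], where t = T]
    unfolding has_bochner_integral_integral_eq[OF D] .
  then have "has_bochner_integral ?M (\<lambda>\<omega>. \<Sum>k\<in>UNIV. indicator {k} (arm \<pi> T \<omega>) * - ln (r k (?Z \<omega>)))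
      (\<Sum>k\<in>UNIV. measure ?M {\<omega> \<in> space ?M. arm \<pi> T \<omega> = k} * D k)"
    by (rule has_bochner_integral_sum)
  from has_bochner_integral_add[OF Suc this]
  have "has_bochner_integral ?M (\<lambda>\<omega>. - ln (likelihood_ratio r T (past \<pi> T \<omega>)) +
        (\<Sum>k\<in>UNIV. indicator {k} (arm \<pi> T \<omega>) * - ln (r k (?Z \<omega>))))
      (\<Sum>k\<in>UNIV. expected_pulls N \<theta> \<pi> (Suc T) k * D k)"
    by (simp add: expected_pulls_def sum.distrib distrib_right)
  moreover have "- ln (likelihood_ratio r T (past \<pi> T \<omega>)) +
        (\<Sum>k\<in>UNIV. indicator {k} (arm \<pi> T \<omega>) * - ln (r k (?Z \<omega>))) =
      - ln (likelihood_ratio r (Suc T) (past \<pi> (Suc T) \<omega>))" for \<omega>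
  proof -
    have "(\<Sum>k\<in>UNIV. indicator {k} (arm \<pi> T \<omega>) * - ln (r k (?Z \<omega>))) =
        (\<Sum>k\<in>UNIV. if k = arm \<pi> T \<omega> then - ln (r k (?Z \<omega>)) else 0)"
      by (intro sum.cong) (auto simp: indicator_def)
    then have "(\<Sum>k\<in>UNIV. indicator {k} (arm \<pi> T \<omega>) * - ln (r k (?Z \<omega>))) = - ln (r (arm \<pi> T \<omega>) (?Z \<omega>))"
      by simp
    moreover have "0 < likelihood_ratio r T (past \<pi> T \<omega>)"
      by (simp add: likelihood_ratio_def prod_pos pos)
    ultimately show ?thesis
      using pos by (simp add: past_Suc likelihood_ratio_extend_past ln_mult_pos arm_eq_choice)
  qed
  ultimately show ?case by simp
qed

text \<open>
  A version of the Bretagnolle--Huber inequality. Both error probabilities together dominate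
  \<open>E (min 1 L) = E (exp (-Y))\<close> with \<open>Y = max 0 (-ln L)\<close>, and Jensen's inequality reduces the
  claim to a bound on \<open>E Y\<close>. Since \<open>ln L \<le> L\<close> and \<open>E L = 1\<close>, replacing \<open>-ln L\<close> by its positive
  part costs at most 1. This additive constant is immaterial for the asymptotics.
\<close>

lemma two_instance_inequality:
  fixes \<pi> :: "('u, 'k::finite) policy"
  assumes pol: "is_policy N \<pi>" and inst: "bandit_instance \<theta>" and inst': "bandit_instance \<theta>'"
    and surrogate: "smean \<theta>' = smean \<theta>" "ssd \<theta>' = ssd \<theta>"
    and r: "\<And>k. r k \<in> borel_measurable (borel \<Otimes>\<^sub>M borel)" and pos: "\<And>k z. 0 < r k z"
    and online: "\<And>k. online_law \<theta>' k = density (online_law \<theta> k) (r k)"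
    and D: "\<And>k. has_bochner_integral (online_law \<theta> k) (\<lambda>z. - ln (r k z)) (D k)"
    and A: "A \<in> sets (past_algebra N \<pi> T)"
  shows "exp (- ((\<Sum>k\<in>UNIV. expected_pulls N \<theta> \<pi> T k * D k) + 1)) \<le>
    measure (bandit_space N \<theta> \<pi>) {\<omega> \<in> space (bandit_space N \<theta> \<pi>). past \<pi> T \<omega> \<in> A} +
    measure (bandit_space N \<theta>' \<pi>) {\<omega> \<in> space (bandit_space N \<theta>' \<pi>). past \<pi> T \<omega> \<notin> A}"
proof -
  let ?M = "bandit_space N \<theta> \<pi>" and ?M' = "bandit_space N \<theta>' \<pi>"
  interpret M: prob_space ?M by (rule prob_space_bandit_space[OF pol inst])
  interpret M': prob_space ?M' by (rule prob_space_bandit_space[OF pol inst'])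
  note [measurable] = past_measurable[OF pol] A likelihood_ratio_measurable[OF r]
  define L where "L \<omega> = likelihood_ratio r T (past \<pi> T \<omega>)" for \<omega>
  define m where "m = (\<Sum>k\<in>UNIV. expected_pulls N \<theta> \<pi> T k * D k) + 1"
  have L_pos: "0 < L \<omega>" for \<omega>
    by (simp add: L_def likelihood_ratio_def prod_pos pos)
  have L_meas [measurable]: "L \<in> borel_measurable ?M"
    unfolding L_def[abs_def] by measurable
  note change = change_of_measure[OF pol inst inst' surrogate r less_imp_le[OF pos] online, of _ T,
      folded L_def]
  have L: "has_bochner_integral ?M L 1"
  proof (rule has_bochner_integral_nn_integral)
    show "(\<integral>\<^sup>+\<omega>. ennreal (L \<omega>) \<partial>?M) = ennreal 1"
      using change[of "\<lambda>_. 1"] M'.emeasure_space_1 by simp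
  qed (simp_all add: less_imp_le[OF L_pos])
  have X: "has_bochner_integral ?M (\<lambda>\<omega>. - ln (L \<omega>)) (m - 1)"
    using has_bochner_integral_neg_ln_likelihood_ratio[OF pol inst pos D] by (simp add: L_def m_def)
  define Y where "Y \<omega> = max 0 (- ln (L \<omega>))" for \<omega>
  have Y_le: "Y \<omega> \<le> - ln (L \<omega>) + L \<omega>" for \<omega>
    using ln_le_minus_one[OF L_pos[of \<omega>]] L_pos[of \<omega>] by (simp add: Y_def)
  have Y_meas [measurable]: "Y \<in> borel_measurable ?M"
    unfolding Y_def[abs_def] by measurable
  have bound: "has_bochner_integral ?M (\<lambda>\<omega>. - ln (L \<omega>) + L \<omega>) m"
    using has_bochner_integral_add[OF X L] by simp
  have Y_int: "integrable ?M Y"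
    by (rule Bochner_Integration.integrable_bound[OF integrable.intros[OF bound]])
      (use Y_le in \<open>auto simp: Y_def intro!: AE_I2\<close>)
  have EY: "(\<integral>\<omega>. Y \<omega> \<partial>?M) \<le> m"
    using integral_mono[OF Y_int integrable.intros[OF bound] Y_le] has_bochner_integral_integral_eq[OF bound]
    by simp
  have exp_Y: "exp (- Y \<omega>) = min 1 (L \<omega>)" for \<omega>
    using L_pos[of \<omega>] by (auto simp: Y_def max_def min_def exp_minus)
  have exp_int: "integrable ?M (\<lambda>\<omega>. exp (- Y \<omega>))"
    by (rule M.integrable_const_bound[where B = 1]) (auto simp: Y_def)
  have prob: "(\<integral>\<^sup>+\<omega>. indicator B (past \<pi> T \<omega>) \<partial>bandit_space N \<eta> \<pi>) =
      emeasure (bandit_space N \<eta> \<pi>) {\<omega> \<in> space (bandit_space N \<eta> \<pi>). past \<pi> T \<omega> \<in> B}"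
    if [measurable]: "Measurable.pred (past_algebra N \<pi> T) (\<lambda>p. p \<in> B)" for B \<eta>
  proof -
    have "(\<integral>\<^sup>+\<omega>. indicator B (past \<pi> T \<omega>) \<partial>bandit_space N \<eta> \<pi>) =
        (\<integral>\<^sup>+\<omega>. indicator {\<omega> \<in> space (bandit_space N \<eta> \<pi>). past \<pi> T \<omega> \<in> B} \<omega> \<partial>bandit_space N \<eta> \<pi>)"
      by (intro nn_integral_cong) (simp add: indicator_def)
    also have "\<dots> = emeasure (bandit_space N \<eta> \<pi>) {\<omega> \<in> space (bandit_space N \<eta> \<pi>). past \<pi> T \<omega> \<in> B}"
      by (rule nn_integral_indicator) measurable
    finally show ?thesis .
  qed
  \<comment> \<open>Jensen's inequality for the exponential, in the form of its tangent at \<open>m\<close>.\<close>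
  have "exp (- m) \<le> exp (- m) * (1 + m - (\<integral>\<omega>. Y \<omega> \<partial>?M))"
    using EY by simp
  also have "\<dots> = (\<integral>\<omega>. exp (- m) * (1 + (m - Y \<omega>)) \<partial>?M)"
    using Y_int M.prob_space by (simp add: algebra_simps)
  also have "\<dots> \<le> (\<integral>\<omega>. exp (- Y \<omega>) \<partial>?M)"
  proof (rule integral_mono)
    fix \<omega>
    have "exp (- m) * (1 + (m - Y \<omega>)) \<le> exp (- m) * exp (m - Y \<omega>)"
      by (intro mult_left_mono exp_ge_add_one_self) simp
    then show "exp (- m) * (1 + (m - Y \<omega>)) \<le> exp (- Y \<omega>)"
      by (simp add: exp_add[symmetric])
  qed (use Y_int exp_int in auto)
  finally have "ennreal (exp (- m)) \<le> ennreal (\<integral>\<omega>. exp (- Y \<omega>) \<partial>?M)"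
    by (rule ennreal_leI)
  also have "\<dots> = (\<integral>\<^sup>+\<omega>. ennreal (exp (- Y \<omega>)) \<partial>?M)"
    by (rule nn_integral_eq_integral[OF exp_int, symmetric]) simp
  also have "\<dots> \<le> (\<integral>\<^sup>+\<omega>. indicator A (past \<pi> T \<omega>) + indicator (- A) (past \<pi> T \<omega>) * ennreal (L \<omega>) \<partial>?M)"
    unfolding exp_Y by (intro nn_integral_mono) (auto simp: indicator_def ennreal_leI)
  also have "\<dots> = (\<integral>\<^sup>+\<omega>. indicator A (past \<pi> T \<omega>) \<partial>?M) +
      (\<integral>\<^sup>+\<omega>. indicator (- A) (past \<pi> T \<omega>) * ennreal (L \<omega>) \<partial>?M)"
    by (rule nn_integral_add) measurable
  also have "(\<integral>\<^sup>+\<omega>. indicator (- A) (past \<pi> T \<omega>) * ennreal (L \<omega>) \<partial>?M) =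
      (\<integral>\<^sup>+\<omega>. indicator (- A) (past \<pi> T \<omega>) \<partial>?M')"
    by (rule change[symmetric]) measurable
  also have "(\<integral>\<^sup>+\<omega>. indicator A (past \<pi> T \<omega>) \<partial>?M) = emeasure ?M {\<omega> \<in> space ?M. past \<pi> T \<omega> \<in> A}"
    by (rule prob) measurable
  also have "(\<integral>\<^sup>+\<omega>. indicator (- A) (past \<pi> T \<omega>) \<partial>?M') = emeasure ?M' {\<omega> \<in> space ?M'. past \<pi> T \<omega> \<notin> A}"
    using prob[of "- A" \<theta>'] by simp
  finally show ?thesis
    by (simp add: M.emeasure_eq_measure M'.emeasure_eq_measure m_def flip: ennreal_plus)
qed

section \<open>Regret and expected numbers of pulls\<close>

lemma best_arm_unique:
  assumes "bandit_instance (\<theta> :: 'k::finite bandit)"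
  shows "mean \<theta> (best_arm \<theta>) = best_mean \<theta>" and "k \<noteq> best_arm \<theta> \<Longrightarrow> mean \<theta> k < best_mean \<theta>"
proof -
  have max: "mean \<theta> k \<le> best_mean \<theta>" for k
    by (simp add: best_mean_def)
  have "best_mean \<theta> \<in> range (mean \<theta>)"
    unfolding best_mean_def by (intro Max_in) auto
  then obtain b where b: "mean \<theta> b = best_mean \<theta>" by auto
  then show best: "mean \<theta> (best_arm \<theta>) = best_mean \<theta>"
    unfolding best_arm_def using arg_max_equality[of "\<lambda>_. True" b "mean \<theta>"] max by auto
  have "inj (mean \<theta>)"
    using assms by (simp add: bandit_instance_def)
  then show "mean \<theta> k < best_mean \<theta>" if "k \<noteq> best_arm \<theta>"
    using max[of k] best that by (metis injD order_le_less)
qed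

lemma gap_pos: "bandit_instance \<theta> \<Longrightarrow> k \<noteq> best_arm \<theta> \<Longrightarrow> 0 < gap \<theta> k"
  by (simp add: gap_def best_arm_unique)

lemma gap_nonneg: "0 \<le> gap \<theta> k"
  by (simp add: gap_def best_mean_def)

lemma expected_pulls_nonneg: "0 \<le> expected_pulls N \<theta> \<pi> T k"
  by (simp add: expected_pulls_def sum_nonneg)

lemma sum_expected_pulls:
  assumes pol: "is_policy N \<pi>" and inst: "bandit_instance \<theta>"
  shows "(\<Sum>k\<in>UNIV. expected_pulls N \<theta> \<pi> T k) = real T"
proof -
  let ?M = "bandit_space N \<theta> \<pi>"
  interpret M: prob_space ?M by (rule prob_space_bandit_space[OF pol inst])
  note [measurable] = arm_measurable[OF pol]
  have "(\<Sum>k\<in>UNIV. measure ?M {\<omega> \<in> space ?M. arm \<pi> t \<omega> = k}) = 1" for t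
  proof -
    have "(\<Sum>k\<in>UNIV. measure ?M {\<omega> \<in> space ?M. arm \<pi> t \<omega> = k}) =
        measure ?M (\<Union>k\<in>UNIV. {\<omega> \<in> space ?M. arm \<pi> t \<omega> = k})"
      by (intro M.finite_measure_finite_Union[symmetric]) (auto simp: disjoint_family_on_def)
    also have "(\<Union>k\<in>UNIV. {\<omega> \<in> space ?M. arm \<pi> t \<omega> = k}) = space ?M"
      by auto
    finally show ?thesis by (simp add: M.prob_space)
  qed
  then show ?thesis
    unfolding expected_pulls_def by (subst sum.swap) simp
qed

lemma pulls_past: "pulls (snd (snd (past \<pi> T \<omega>))) T k = card {t. t < T \<and> arm \<pi> t \<omega> = k}"
proof (induction T)
  case 0
  show ?case by (simp add: pulls_def)
next
  case (Suc T)
  have "{t. t < Suc T \<and> arm \<pi> t \<omega> = k} = (if arm \<pi> T \<omega> = k then insert T {t. t < T \<and> arm \<pi> t \<omega> = k}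
      else {t. t < T \<and> arm \<pi> t \<omega> = k})"
    by (auto simp: less_Suc_eq)
  moreover have "pulls (snd (snd (past \<pi> (Suc T) \<omega>))) (Suc T) k =
      pulls (snd (snd (past \<pi> T \<omega>))) T k + (if arm \<pi> T \<omega> = k then 1 else 0)"
    unfolding past_Suc extend_past_def snd_conv pulls_fun_upd arm_eq_choice ..
  ultimately show ?case
    using Suc by simp
qed

lemma has_bochner_integral_pulls:
  assumes pol: "is_policy N \<pi>" and inst: "bandit_instance \<theta>"
  shows "has_bochner_integral (bandit_space N \<theta> \<pi>)
    (\<lambda>\<omega>. real (pulls (snd (snd (past \<pi> T \<omega>))) T k)) (expected_pulls N \<theta> \<pi> T k)"
proof -
  let ?M = "bandit_space N \<theta> \<pi>"
  interpret M: prob_space ?M by (rule prob_space_bandit_space[OF pol inst])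
  note [measurable] = arm_measurable[OF pol]
  have "has_bochner_integral ?M (\<lambda>\<omega>. \<Sum>t<T. indicator {\<omega> \<in> space ?M. arm \<pi> t \<omega> = k} \<omega> :: real)
      (expected_pulls N \<theta> \<pi> T k)"
    unfolding expected_pulls_def
    by (intro has_bochner_integral_sum has_bochner_integral_real_indicator)
      (auto simp: M.emeasure_eq_measure)
  moreover have "(\<Sum>t<T. indicator {\<omega> \<in> space ?M. arm \<pi> t \<omega> = k} \<omega> :: real) =
      real (pulls (snd (snd (past \<pi> T \<omega>))) T k)" if "\<omega> \<in> space ?M" for \<omega>
  proof -
    have "{t. t < T \<and> arm \<pi> t \<omega> = k} = {t \<in> {..<T}. arm \<pi> t \<omega> = k}" by auto
    with that show ?thesis
      by (simp add: pulls_past indicator_def sum.If_cases Int_def)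
  qed
  ultimately show ?thesis
    by (subst (asm) has_bochner_integral_cong[OF refl _ refl]) auto
qed

lemma expected_regret_eq:
  assumes pol: "is_policy N \<pi>" and inst: "bandit_instance \<theta>"
  shows "expected_regret N \<theta> \<pi> T = (\<Sum>k\<in>UNIV. gap \<theta> k * expected_pulls N \<theta> \<pi> T k)"
proof -
  have "regret \<theta> \<pi> T \<omega> = (\<Sum>k\<in>UNIV. gap \<theta> k * real (pulls (snd (snd (past \<pi> T \<omega>))) T k))" for \<omega>
  proof -
    have "regret \<theta> \<pi> T \<omega> = (\<Sum>k\<in>UNIV. \<Sum>t | t \<in> {..<T} \<and> arm \<pi> t \<omega> = k. gap \<theta> (arm \<pi> t \<omega>))"
      unfolding regret_def gap_def by (rule sum.group[symmetric]) auto
    also have "\<dots> = (\<Sum>k\<in>UNIV. gap \<theta> k * real (pulls (snd (snd (past \<pi> T \<omega>))) T k))"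
      by (intro sum.cong) (simp_all add: pulls_past)
    finally show ?thesis .
  qed
  then have "expected_regret N \<theta> \<pi> T =
      (\<integral>\<omega>. (\<Sum>k\<in>UNIV. gap \<theta> k * real (pulls (snd (snd (past \<pi> T \<omega>))) T k)) \<partial>bandit_space N \<theta> \<pi>)"
    by (simp add: expected_regret_def)
  also have "\<dots> = (\<Sum>k\<in>UNIV. gap \<theta> k * expected_pulls N \<theta> \<pi> T k)"
    by (intro has_bochner_integral_integral_eq has_bochner_integral_sum has_bochner_integral_mult_right
        has_bochner_integral_pulls[OF pol inst])
  finally show ?thesis .
qed

section \<open>A Gaussian alternative with unchanged surrogates\<close>

definition residual_sd :: "'k bandit \<Rightarrow> 'k \<Rightarrow> real" where
  "residual_sd \<theta> k = sd \<theta> k * sqrt (1 - (corr \<theta> k)\<^sup>2)"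

text \<open>
  The deviation of the true reward from its linear regression on the surrogate reward.
\<close>

definition residual :: "'k bandit \<Rightarrow> 'k \<Rightarrow> real \<times> real \<Rightarrow> real" where
  "residual \<theta> k z = fst z - (mean \<theta> k + corr \<theta> k * sd \<theta> k / ssd \<theta> k * (snd z - smean \<theta> k))"

lemma sd_pos: "bandit_instance \<theta> \<Longrightarrow> 0 < sd \<theta> k"
  by (simp add: bandit_instance_def)

lemma residual_measurable [measurable]: "residual \<theta> k \<in> borel_measurable (borel \<Otimes>\<^sub>M borel)"
  unfolding residual_def by measurable

lemma residual_sd_pos: "bandit_instance \<theta> \<Longrightarrow> 0 < residual_sd \<theta> k"
  by (auto simp: bandit_instance_def residual_sd_def abs_square_less_1)

lemma residual_sd_sq:
  assumes "bandit_instance \<theta>"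
  shows "(residual_sd \<theta> k)\<^sup>2 = (sd \<theta> k)\<^sup>2 * (1 - (corr \<theta> k)\<^sup>2)"
proof -
  have "(corr \<theta> k)\<^sup>2 < 1"
    using assms by (simp add: bandit_instance_def abs_square_less_1)
  then show ?thesis
    by (simp add: residual_sd_def power_mult_distrib)
qed

lemma online_law_eq_density:
  assumes "bandit_instance \<theta>"
  shows "online_law \<theta> k = density lborel (\<lambda>z. ennreal (normal_density (smean \<theta> k) (ssd \<theta> k) (snd z) *
    normal_density 0 (residual_sd \<theta> k) (residual \<theta> k z)))"
proof -
  have "normal2_density (mean \<theta> k, smean \<theta> k) (cov_matrix \<theta> k) z =
    normal_density (smean \<theta> k) (ssd \<theta> k) (snd z) * normal_density 0 (residual_sd \<theta> k) (residual \<theta> k z)" for z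
    using normal2_density_cov_matrix[OF assms, of k "fst z" "snd z"]
    by (simp add: residual_sd_def residual_def normal_density_def)
  then show ?thesis
    by (simp add: online_law_def normal2_def)
qed

text \<open>
  Conditionally on the surrogate reward \<open>y\<close>, the true reward is normal with a mean affine in \<open>y\<close>
  and a variance free of \<open>y\<close>; subtracting the mean leaves the same law for every \<open>y\<close>.
\<close>

lemma distr_residual:
  assumes inst: "bandit_instance \<theta>"
  shows "distr (online_law \<theta> k) borel (residual \<theta> k) = density lborel (normal_density 0 (residual_sd \<theta> k))"
proof (rule measure_eqI)
  fix A assume "A \<in> sets (distr (online_law \<theta> k) borel (residual \<theta> k))"
  then have A [measurable]: "A \<in> sets borel" by simp
  let ?n = "normal_density (smean \<theta> k) (ssd \<theta> k)"
  let ?g = "\<lambda>e. ennreal (normal_density 0 (residual_sd \<theta> k) e) * indicator A e"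
  let ?c = "\<lambda>y. mean \<theta> k + corr \<theta> k * sd \<theta> k / ssd \<theta> k * (y - smean \<theta> k)"
  have "ssd \<theta> k > 0"
    using inst by (simp add: bandit_instance_def)
  then have one: "(\<integral>\<^sup>+y. ennreal (?n y) \<partial>lborel) = 1"
    using prob_space.emeasure_space_1[OF prob_space_normal_density] by (simp add: emeasure_density)
  have meas: "(\<lambda>z. ennreal (?n (snd z)) * ?g (residual \<theta> k z)) \<in> borel_measurable (lborel \<Otimes>\<^sub>M lborel)"
    by measurable
  have "emeasure (distr (online_law \<theta> k) borel (residual \<theta> k)) A =
      (\<integral>\<^sup>+z. indicator A (residual \<theta> k z) \<partial>online_law \<theta> k)"
    using A by (simp add: nn_integral_distr flip: nn_integral_indicator)
  also have "\<dots> = (\<integral>\<^sup>+z. ennreal (?n (snd z)) * ?g (residual \<theta> k z) \<partial>(lborel \<Otimes>\<^sub>M lborel))"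
    unfolding online_law_eq_density[OF inst] lborel_prod
    by (subst nn_integral_density)
      (auto simp: ennreal_mult mult.assoc simp flip: borel_prod)
  also have "\<dots> = (\<integral>\<^sup>+y. \<integral>\<^sup>+x. ennreal (?n y) * ?g (residual \<theta> k (x, y)) \<partial>lborel \<partial>lborel)"
    using lborel_pair.nn_integral_snd[OF meas[unfolded case_prod_beta]] by simp
  also have "\<dots> = (\<integral>\<^sup>+y. ennreal (?n y) * (\<integral>\<^sup>+x. ?g (residual \<theta> k (x, y)) \<partial>lborel) \<partial>lborel)"
    by (intro nn_integral_cong nn_integral_cmult) (simp add: residual_def)
  also have "\<dots> = (\<integral>\<^sup>+y. ennreal (?n y) * (\<integral>\<^sup>+e. ?g e \<partial>lborel) \<partial>lborel)"
  proof (rule nn_integral_cong)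
    fix y
    have "residual \<theta> k (x, y) = - ?c y + 1 * x" for x
      by (simp add: residual_def)
    then have "(\<integral>\<^sup>+x. ?g (residual \<theta> k (x, y)) \<partial>lborel) = (\<integral>\<^sup>+e. ?g e \<partial>lborel)"
      by (subst nn_integral_real_affine[of ?g 1 "- ?c y"]) simp_all
    then show "ennreal (?n y) * (\<integral>\<^sup>+x. ?g (residual \<theta> k (x, y)) \<partial>lborel) =
        ennreal (?n y) * (\<integral>\<^sup>+e. ?g e \<partial>lborel)"
      by (simp only:)
  qed
  also have "\<dots> = (\<integral>\<^sup>+e. ?g e \<partial>lborel)"
    by (simp add: nn_integral_multc one)
  finally show "emeasure (distr (online_law \<theta> k) borel (residual \<theta> k)) A =
      emeasure (density lborel (normal_density 0 (residual_sd \<theta> k))) A"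
    by (simp add: emeasure_density)
qed simp

lemma has_bochner_integral_residual:
  assumes inst: "bandit_instance \<theta>" and [measurable]: "g \<in> borel_measurable borel"
    and g: "has_bochner_integral lborel (\<lambda>e. normal_density 0 (residual_sd \<theta> k) e * g e) (I :: real)"
  shows "has_bochner_integral (online_law \<theta> k) (\<lambda>z. g (residual \<theta> k z)) I"
proof -
  have [measurable]: "residual \<theta> k \<in> online_law \<theta> k \<rightarrow>\<^sub>M borel"
    by measurable
  have "integrable (distr (online_law \<theta> k) borel (residual \<theta> k)) g"
    "(\<integral>e. g e \<partial>distr (online_law \<theta> k) borel (residual \<theta> k)) = I"
    using g unfolding distr_residual[OF inst]
    by (simp_all add: integrable_real_density integral_real_density has_bochner_integral_iff)
  then show ?thesis
    by (simp add: integrable_distr_eq integral_distr has_bochner_integral_iff)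
qed

text \<open>
  The relative entropy of \<open>N(0, v\<^sup>2)\<close> with respect to \<open>N(\<delta>, w\<^sup>2)\<close> is
  \<open>ln (w / v) + (v\<^sup>2 + \<delta>\<^sup>2) / (2 w\<^sup>2) - 1 / 2\<close>. The choice \<open>w\<^sup>2 = v\<^sup>2 + \<delta>\<^sup>2\<close> minimises it over \<open>w\<close>
  and cancels the last two terms.
\<close>

lemma has_bochner_integral_normal_log_ratio:
  fixes v \<delta> :: real
  assumes v: "0 < v"
  defines "w \<equiv> sqrt (v\<^sup>2 + \<delta>\<^sup>2)"
  shows "has_bochner_integral lborel
    (\<lambda>e. normal_density 0 v e * - ln (normal_density \<delta> w e / normal_density 0 v e))
    (ln (1 + \<delta>\<^sup>2 / v\<^sup>2) / 2)"
proof -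
  have w2: "w\<^sup>2 = v\<^sup>2 + \<delta>\<^sup>2"
    by (simp add: w_def)
  have "v\<^sup>2 > 0" using v by simp
  then have "w\<^sup>2 > 0" by (simp add: w2 add_pos_nonneg)
  have w: "w > 0"
    unfolding w_def using \<open>v\<^sup>2 > 0\<close> by (simp add: add_pos_nonneg)
  have ratio: "ln w - ln v = ln (1 + \<delta>\<^sup>2 / v\<^sup>2) / 2"
  proof -
    have "1 + \<delta>\<^sup>2 / v\<^sup>2 = (w / v)\<^sup>2"
      using v by (simp add: power_divide w2 field_simps)
    then have "ln (1 + \<delta>\<^sup>2 / v\<^sup>2) = 2 * ln (w / v)"
      using v w by (simp add: ln_realpow)
    then show ?thesis using v w by (simp add: ln_div)
  qed
  have pointwise: "- ln (normal_density \<delta> w e / normal_density 0 v e) =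
      (ln w - ln v + \<delta>\<^sup>2 / (2 * w\<^sup>2)) * e ^ 0 - \<delta> / w\<^sup>2 * e ^ 1 + (1 / (2 * w\<^sup>2) - 1 / (2 * v\<^sup>2)) * e ^ 2" for e
  proof -
    have ln_density: "ln (normal_density m s e) = - (e - m)\<^sup>2 / (2 * s\<^sup>2) - ln (sqrt (2 * pi)) - ln s" if "s > 0" for m s
      using that by (simp add: normal_density_def ln_mult ln_div real_sqrt_mult)
    have "ln (normal_density \<delta> w e / normal_density 0 v e) =
        - (e - \<delta>)\<^sup>2 / (2 * w\<^sup>2) - ln w - (- e\<^sup>2 / (2 * v\<^sup>2) - ln v)"
      using v w normal_density_pos[OF v, of 0 e] normal_density_pos[OF w, of \<delta> e] by (simp add: ln_div ln_density)
    then show ?thesis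
      by (simp add: power2_diff diff_divide_distrib add_divide_distrib algebra_simps)
  qed
  have "has_bochner_integral lborel (\<lambda>e.
      (ln w - ln v + \<delta>\<^sup>2 / (2 * w\<^sup>2)) * (normal_density 0 v e * e ^ 0) -
      \<delta> / w\<^sup>2 * (normal_density 0 v e * e ^ 1) +
      (1 / (2 * w\<^sup>2) - 1 / (2 * v\<^sup>2)) * (normal_density 0 v e * e ^ 2))
    ((ln w - ln v + \<delta>\<^sup>2 / (2 * w\<^sup>2)) * 1 - \<delta> / w\<^sup>2 * 0 + (1 / (2 * w\<^sup>2) - 1 / (2 * v\<^sup>2)) * v\<^sup>2)"
    using normal_moment_even[OF v, of 0 0] normal_moment_even[OF v, of 0 1] normal_moment_odd[OF v, of 0 0]
    by (intro has_bochner_integral_add has_bochner_integral_diff has_bochner_integral_mult_right)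
      (simp_all add: fact_numeral)
  moreover have "(ln w - ln v + \<delta>\<^sup>2 / (2 * w\<^sup>2)) * 1 - \<delta> / w\<^sup>2 * 0 + (1 / (2 * w\<^sup>2) - 1 / (2 * v\<^sup>2)) * v\<^sup>2 =
      ln (1 + \<delta>\<^sup>2 / v\<^sup>2) / 2"
  proof -
    have "(1 / (2 * W) - 1 / (2 * V)) * V = (V - W) / (2 * W)" if "V > 0" "W > 0" for V W :: real
      using that by (simp add: field_simps)
    from this[OF \<open>v\<^sup>2 > 0\<close> \<open>w\<^sup>2 > 0\<close>]
    have "(1 / (2 * w\<^sup>2) - 1 / (2 * v\<^sup>2)) * v\<^sup>2 = - \<delta>\<^sup>2 / (2 * w\<^sup>2)"
      by (simp add: w2)
    then show ?thesis by (simp add: ratio)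
  qed
  moreover have "(\<lambda>e. normal_density 0 v e * - ln (normal_density \<delta> w e / normal_density 0 v e)) = (\<lambda>e.
      (ln w - ln v + \<delta>\<^sup>2 / (2 * w\<^sup>2)) * (normal_density 0 v e * e ^ 0) -
      \<delta> / w\<^sup>2 * (normal_density 0 v e * e ^ 1) +
      (1 / (2 * w\<^sup>2) - 1 / (2 * v\<^sup>2)) * (normal_density 0 v e * e ^ 2))"
    unfolding pointwise by (simp add: fun_eq_iff algebra_simps)
  ultimately show ?thesis
    by (simp only:)
qed

text \<open>
  The parameters are determined by three requirements: the covariance \<open>corr * sd * ssd\<close> with the
  surrogate is kept, and with it the regression slope; the mean rises by \<open>\<delta>\<close>; the residual variance
  rises by \<open>\<delta>\<^sup>2\<close>. As the variance of the true reward is the residual variance plus the variance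
  explained by the surrogate, it rises by \<open>\<delta>\<^sup>2\<close> as well.
\<close>

definition raise_arm :: "'k bandit \<Rightarrow> 'k \<Rightarrow> real \<Rightarrow> 'k bandit" where
  "raise_arm \<theta> k \<delta> = \<theta>\<lparr>
     mean := (mean \<theta>)(k := mean \<theta> k + \<delta>),
     sd := (sd \<theta>)(k := sqrt ((sd \<theta> k)\<^sup>2 + \<delta>\<^sup>2)),
     corr := (corr \<theta>)(k := corr \<theta> k * sd \<theta> k / sqrt ((sd \<theta> k)\<^sup>2 + \<delta>\<^sup>2))\<rparr>"

lemma raise_arm_simps:
  "smean (raise_arm \<theta> k \<delta>) = smean \<theta>" "ssd (raise_arm \<theta> k \<delta>) = ssd \<theta>"
  "mean (raise_arm \<theta> k \<delta>) = (mean \<theta>)(k := mean \<theta> k + \<delta>)"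
  by (simp_all add: raise_arm_def)

text \<open>
  Raising the arm strictly above the best mean keeps the means distinct, so the alternative is an
  admissible instance and the hypothesis on the policy applies to it.
\<close>

lemma bandit_instance_raise_arm:
  assumes inst: "bandit_instance \<theta>" and \<delta>: "best_mean \<theta> < mean \<theta> k + \<delta>"
  shows "bandit_instance (raise_arm \<theta> k \<delta>)"
proof -
  let ?s = "sqrt ((sd \<theta> k)\<^sup>2 + \<delta>\<^sup>2)"
  have sd: "0 < sd \<theta> k" and c: "\<bar>corr \<theta> k\<bar> < 1" and inj: "inj (mean \<theta>)"
    using inst by (auto simp: bandit_instance_def)
  have "0 < (sd \<theta> k)\<^sup>2 + \<delta>\<^sup>2"
    using sd by (simp add: add_pos_nonneg)
  have s: "sd \<theta> k \<le> ?s"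
    using sd by (simp add: real_le_rsqrt)
  have "\<bar>corr \<theta> k * sd \<theta> k\<bar> < 1 * sd \<theta> k"
    using c sd by (simp add: abs_mult)
  then have corr: "\<bar>corr \<theta> k * sd \<theta> k / ?s\<bar> < 1"
    using s sd divide_less_eq_1_pos[of ?s "\<bar>corr \<theta> k * sd \<theta> k\<bar>"] by (simp only: abs_divide) linarith
  have "mean \<theta> j < mean \<theta> k + \<delta>" for j
    using \<delta> by (rule le_less_trans[rotated]) (simp add: best_mean_def)
  then have "inj ((mean \<theta>)(k := mean \<theta> k + \<delta>))"
    using inj by (intro inj_onI) (auto simp: inj_def split: if_splits, (metis less_irrefl)+)
  with inst \<open>0 < (sd \<theta> k)\<^sup>2 + \<delta>\<^sup>2\<close> corr show ?thesis
    by (auto simp: bandit_instance_def raise_arm_def)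
qed

lemma residual_sd_raise_arm:
  assumes inst: "bandit_instance \<theta>"
  shows "residual_sd (raise_arm \<theta> k \<delta>) k = sqrt ((residual_sd \<theta> k)\<^sup>2 + \<delta>\<^sup>2)"
proof -
  let ?q = "(sd \<theta> k)\<^sup>2 + \<delta>\<^sup>2"
  have "0 < (sd \<theta> k)\<^sup>2" using sd_pos[OF inst, of k] by simp
  then have q: "?q > 0" by (simp add: add_pos_nonneg)
  have "residual_sd (raise_arm \<theta> k \<delta>) k = sqrt ?q * sqrt (1 - (corr \<theta> k)\<^sup>2 * (sd \<theta> k)\<^sup>2 / ?q)"
    using q by (simp add: residual_sd_def raise_arm_def power_divide power_mult_distrib)
  also have "\<dots> = sqrt (?q * (1 - (corr \<theta> k)\<^sup>2 * (sd \<theta> k)\<^sup>2 / ?q))"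
    by (simp add: real_sqrt_mult)
  also have "?q * (1 - (corr \<theta> k)\<^sup>2 * (sd \<theta> k)\<^sup>2 / ?q) = (residual_sd \<theta> k)\<^sup>2 + \<delta>\<^sup>2"
    using q by (simp add: residual_sd_sq[OF inst] right_diff_distrib)
  finally show ?thesis .
qed

lemma residual_raise_arm:
  assumes inst: "bandit_instance \<theta>"
  shows "residual (raise_arm \<theta> k \<delta>) k z = residual \<theta> k z - \<delta>"
proof -
  have "0 < (sd \<theta> k)\<^sup>2" using sd_pos[OF inst, of k] by simp
  then have "(sd \<theta> k)\<^sup>2 + \<delta>\<^sup>2 > 0" by (simp add: add_pos_nonneg)
  then show ?thesis
    by (simp add: residual_def raise_arm_def)
qed

text \<open>
  The factor for the surrogate is common to both online laws and cancels, so the density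
  ratio depends on the observation through the residual only.
\<close>

definition raise_ratio :: "'k bandit \<Rightarrow> 'k \<Rightarrow> real \<Rightarrow> 'k \<Rightarrow> real \<times> real \<Rightarrow> real" where
  "raise_ratio \<theta> k \<delta> j z = (if j = k
     then normal_density \<delta> (sqrt ((residual_sd \<theta> k)\<^sup>2 + \<delta>\<^sup>2)) (residual \<theta> k z) /
       normal_density 0 (residual_sd \<theta> k) (residual \<theta> k z)
     else 1)"

lemma raise_ratio_measurable [measurable]: "raise_ratio \<theta> k \<delta> j \<in> borel_measurable (borel \<Otimes>\<^sub>M borel)"
  unfolding raise_ratio_def by (cases "j = k") simp_all

lemma raise_ratio_pos:
  assumes "bandit_instance \<theta>"
  shows "0 < raise_ratio \<theta> k \<delta> j z"
proof -
  have "0 < (residual_sd \<theta> k)\<^sup>2 + \<delta>\<^sup>2"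
    using residual_sd_pos[OF assms, of k] by (simp add: add_pos_nonneg)
  then show ?thesis
    by (simp add: raise_ratio_def normal_density_pos residual_sd_pos[OF assms])
qed

lemma online_law_raise_arm:
  assumes inst: "bandit_instance \<theta>" and inst': "bandit_instance (raise_arm \<theta> k \<delta>)"
  shows "online_law (raise_arm \<theta> k \<delta>) j = density (online_law \<theta> j) (raise_ratio \<theta> k \<delta> j)"
proof (cases "j = k")
  case True
  let ?v = "residual_sd \<theta> k"
  have cancel: "normal_density 0 ?v x \<noteq> 0" for x
    using normal_density_pos[OF residual_sd_pos[OF inst], of 0 k x] by simp
  have shift: "normal_density 0 s (x - \<delta>) = normal_density \<delta> s x" for s x
    by (simp add: normal_density_def)
  have "density (online_law \<theta> k) (raise_ratio \<theta> k \<delta> k) = density lborel (\<lambda>z.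
      ennreal (normal_density (smean \<theta> k) (ssd \<theta> k) (snd z) * normal_density 0 ?v (residual \<theta> k z)) *
      ennreal (raise_ratio \<theta> k \<delta> k z))"
    unfolding online_law_eq_density[OF inst]
    by (rule density_density_eq) (simp_all flip: borel_prod)
  also have "\<dots> = online_law (raise_arm \<theta> k \<delta>) k"
    unfolding online_law_eq_density[OF inst'] residual_raise_arm[OF inst] residual_sd_raise_arm[OF inst]
      raise_arm_simps
    by (intro arg_cong[where f = "density lborel"] ext)
      (simp add: raise_ratio_def cancel shift flip: ennreal_mult)
  finally show ?thesis using True by simp
next
  case False
  then show ?thesis
    by (simp add: raise_ratio_def[abs_def] online_law_def cov_matrix_def raise_arm_def density_1)
qed

lemma has_bochner_integral_raise_ratio:
  assumes inst: "bandit_instance \<theta>"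
  shows "has_bochner_integral (online_law \<theta> j) (\<lambda>z. - ln (raise_ratio \<theta> k \<delta> j z))
    (if j = k then ln (1 + \<delta>\<^sup>2 / (residual_sd \<theta> k)\<^sup>2) / 2 else 0)"
proof (cases "j = k")
  case True
  have "has_bochner_integral (online_law \<theta> k)
      (\<lambda>z. (\<lambda>e. - ln (normal_density \<delta> (sqrt ((residual_sd \<theta> k)\<^sup>2 + \<delta>\<^sup>2)) e / normal_density 0 (residual_sd \<theta> k) e))
        (residual \<theta> k z))
      (ln (1 + \<delta>\<^sup>2 / (residual_sd \<theta> k)\<^sup>2) / 2)"
    by (rule has_bochner_integral_residual[OF inst _
          has_bochner_integral_normal_log_ratio[OF residual_sd_pos[OF inst]]]) measurable
  with True show ?thesis
    by (simp add: raise_ratio_def)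
qed (simp add: raise_ratio_def has_bochner_integral_zero)

section \<open>The asymptotic lower bound\<close>

lemma expected_pulls_le:
  assumes pol: "is_policy N \<pi>" and inst: "bandit_instance \<theta>"
    and J: "\<And>j. j \<in> J \<Longrightarrow> c \<le> gap \<theta> j" and c: "0 < c"
  shows "(\<Sum>j\<in>J. expected_pulls N \<theta> \<pi> T j) \<le> expected_regret N \<theta> \<pi> T / c"
proof -
  have "c * (\<Sum>j\<in>J. expected_pulls N \<theta> \<pi> T j) \<le> (\<Sum>j\<in>J. gap \<theta> j * expected_pulls N \<theta> \<pi> T j)"
    unfolding sum_distrib_left by (intro sum_mono mult_right_mono J expected_pulls_nonneg)
  also have "\<dots> \<le> expected_regret N \<theta> \<pi> T"
    unfolding expected_regret_eq[OF pol inst]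
    by (intro sum_mono2) (auto intro!: mult_nonneg_nonneg gap_nonneg expected_pulls_nonneg)
  finally show ?thesis
    using c by (simp add: pos_le_divide_eq mult.commute)
qed

lemma gap_raise_arm:
  assumes "best_mean \<theta> + \<epsilon> \<le> mean \<theta> k + \<delta>" "j \<noteq> k"
  shows "\<epsilon> \<le> gap (raise_arm \<theta> k \<delta>) j"
proof -
  have "mean \<theta> k + \<delta> \<le> best_mean (raise_arm \<theta> k \<delta>)"
    unfolding best_mean_def raise_arm_simps by (rule Max_ge) (auto intro!: image_eqI[of _ _ k])
  moreover have "mean \<theta> j \<le> best_mean \<theta>"
    by (simp add: best_mean_def)
  ultimately show ?thesis
    using assms by (simp add: gap_def raise_arm_simps)
qed

text \<open>
  The two errors are to play \<open>k\<close> at least \<open>T/2\<close> times under \<open>\<theta>\<close>, where each such round costs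
  \<open>gap \<theta> k\<close>, and to play it less often under the raised instance, where each of the
  other rounds costs at least \<open>\<epsilon>\<close>. Markov's inequality bounds their probabilities by the regrets.
\<close>

lemma exp_expected_pulls_le_regret:
  fixes \<pi> :: "('u, 'k::finite) policy"
  assumes pol: "is_policy N \<pi>" and inst: "bandit_instance \<theta>" and k: "k \<noteq> best_arm \<theta>"
    and \<epsilon>: "0 < \<epsilon>" and T: "0 < T"
  shows "exp (- (expected_pulls N \<theta> \<pi> T k * (ln (1 + (gap \<theta> k + \<epsilon>)\<^sup>2 / (residual_sd \<theta> k)\<^sup>2) / 2) + 1)) \<le>
    2 / T * (expected_regret N \<theta> \<pi> T / gap \<theta> k +
      expected_regret N (raise_arm \<theta> k (gap \<theta> k + \<epsilon>)) \<pi> T / \<epsilon>)"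
proof -
  define \<delta> where "\<delta> = gap \<theta> k + \<epsilon>"
  define \<theta>' where "\<theta>' = raise_arm \<theta> k \<delta>"
  define d where "d = ln (1 + \<delta>\<^sup>2 / (residual_sd \<theta> k)\<^sup>2) / 2"
  let ?n = "\<lambda>p :: 'u \<times> 'k offline \<times> 'k history. real (pulls (snd (snd p)) T k)"
  have inst': "bandit_instance \<theta>'"
    unfolding \<theta>'_def using \<epsilon> by (intro bandit_instance_raise_arm inst) (simp add: \<delta>_def gap_def)
  let ?M = "bandit_space N \<theta> \<pi>" and ?M' = "bandit_space N \<theta>' \<pi>"
  interpret M: prob_space ?M by (rule prob_space_bandit_space[OF pol inst])
  interpret M': prob_space ?M' by (rule prob_space_bandit_space[OF pol inst'])
  define A where "A = {p \<in> space (past_algebra N \<pi> T). T / 2 \<le> ?n p}"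
  have n [measurable]: "?n \<in> borel_measurable (past_algebra N \<pi> T)"
    unfolding past_algebra_def by measurable
  have A: "A \<in> sets (past_algebra N \<pi> T)"
    unfolding A_def by measurable
  have in_A: "past \<pi> T \<omega> \<in> A \<longleftrightarrow> T / 2 \<le> ?n (past \<pi> T \<omega>)" if "\<omega> \<in> space (bandit_space N \<eta> \<pi>)" for \<omega> \<eta>
    using measurable_space[OF past_measurable[OF pol] that] by (simp add: A_def)
  note pulls = has_bochner_integral_pulls[OF pol inst, of T k]
  note pulls' = has_bochner_integral_pulls[OF pol inst', of T k]
  have P: "measure ?M {\<omega> \<in> space ?M. past \<pi> T \<omega> \<in> A} \<le> 2 / T * (expected_regret N \<theta> \<pi> T / gap \<theta> k)"
  proof -
    have "measure ?M {\<omega> \<in> space ?M. past \<pi> T \<omega> \<in> A} = measure ?M {\<omega> \<in> space ?M. T / 2 \<le> ?n (past \<pi> T \<omega>)}"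
      by (rule arg_cong[where f = "measure ?M"]) (auto simp: in_A)
    also have "\<dots> \<le> (\<integral>\<omega>. ?n (past \<pi> T \<omega>) \<partial>?M) / (T / 2)"
      by (rule integral_Markov_inequality_measure[where A = "{}"]) (use pulls T in \<open>auto intro: integrable.intros\<close>)
    also have "(\<integral>\<omega>. ?n (past \<pi> T \<omega>) \<partial>?M) = expected_pulls N \<theta> \<pi> T k"
      by (rule has_bochner_integral_integral_eq[OF pulls])
    also have "\<dots> \<le> expected_regret N \<theta> \<pi> T / gap \<theta> k"
      using expected_pulls_le[OF pol inst, of "{k}" "gap \<theta> k" T] gap_pos[OF inst k] by simp
    finally show ?thesis
      using T by (simp add: divide_right_mono mult.commute)
  qed
  have P': "measure ?M' {\<omega> \<in> space ?M'. past \<pi> T \<omega> \<notin> A} \<le> 2 / T * (expected_regret N \<theta>' \<pi> T / \<epsilon>)"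
  proof -
    have others: "has_bochner_integral ?M' (\<lambda>\<omega>. T - ?n (past \<pi> T \<omega>)) (T - expected_pulls N \<theta>' \<pi> T k)"
      using has_bochner_integral_diff[OF _ pulls', of "\<lambda>_. real T" "real T"] M'.prob_space
      by (simp add: has_bochner_integral_iff)
    have "measure ?M' {\<omega> \<in> space ?M'. past \<pi> T \<omega> \<notin> A} \<le>
        measure ?M' {\<omega> \<in> space ?M'. T / 2 \<le> T - ?n (past \<pi> T \<omega>)}"
    proof (rule M'.finite_measure_mono)
      have [measurable]: "(\<lambda>\<omega>. ?n (past \<pi> T \<omega>)) \<in> borel_measurable ?M'"
        by (rule borel_measurable_has_bochner_integral[OF pulls'])
      show "{\<omega> \<in> space ?M'. T / 2 \<le> T - ?n (past \<pi> T \<omega>)} \<in> sets ?M'"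
        by measurable
    qed (auto simp: in_A)
    also have "\<dots> \<le> (\<integral>\<omega>. T - ?n (past \<pi> T \<omega>) \<partial>?M') / (T / 2)"
      by (rule integral_Markov_inequality_measure[where A = "{}"])
        (use others T in \<open>auto intro: integrable.intros simp: pulls_le\<close>)
    also have "(\<integral>\<omega>. T - ?n (past \<pi> T \<omega>) \<partial>?M') = T - expected_pulls N \<theta>' \<pi> T k"
      by (rule has_bochner_integral_integral_eq[OF others])
    also have "\<dots> = (\<Sum>j\<in>UNIV - {k}. expected_pulls N \<theta>' \<pi> T j)"
      using sum_expected_pulls[OF pol inst', of T] by (simp add: sum.remove[of UNIV k])
    also have "\<dots> \<le> expected_regret N \<theta>' \<pi> T / \<epsilon>"
    proof (rule expected_pulls_le[OF pol inst' _ \<epsilon>])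
      show "\<epsilon> \<le> gap \<theta>' j" if "j \<in> UNIV - {k}" for j
        unfolding \<theta>'_def using that by (intro gap_raise_arm) (auto simp: \<delta>_def gap_def)
    qed
    finally show ?thesis
      using T by (simp add: divide_right_mono mult.commute)
  qed
  have sum: "(\<Sum>j\<in>UNIV. expected_pulls N \<theta> \<pi> T j * (if j = k then d else 0)) = expected_pulls N \<theta> \<pi> T k * d"
    by (simp add: if_distrib cong: if_cong)
  have "exp (- ((\<Sum>j\<in>UNIV. expected_pulls N \<theta> \<pi> T j * (if j = k then d else 0)) + 1)) \<le>
    measure ?M {\<omega> \<in> space ?M. past \<pi> T \<omega> \<in> A} + measure ?M' {\<omega> \<in> space ?M'. past \<pi> T \<omega> \<notin> A}"
    using inst' unfolding \<theta>'_def d_def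
    by (intro two_instance_inequality[OF pol inst _ _ _ raise_ratio_measurable raise_ratio_pos[OF inst]
          online_law_raise_arm[OF inst] has_bochner_integral_raise_ratio[OF inst] A])
      (simp_all add: raise_arm_simps)
  also have "\<dots> \<le> 2 / T * (expected_regret N \<theta> \<pi> T / gap \<theta> k + expected_regret N \<theta>' \<pi> T / \<epsilon>)"
    using add_mono[OF P P'] by (simp only: distrib_left)
  finally show ?thesis
    unfolding sum unfolding \<theta>'_def d_def \<delta>_def .
qed

text \<open>
  The loss factor \<open>1 - e\<close> absorbs three small terms: the difference between the gap and
  \<open>gap + \<epsilon>\<close>, the exponent \<open>e / 4\<close> in the regret bound, and the additive constant of the two-instance
  inequality.
\<close>

lemma eventually_expected_pulls_ge:
  fixes \<pi> :: "('u, 'k::finite) policy"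
  assumes pol: "is_policy N \<pi>" and good: "uniformly_good N \<pi>" and inst: "bandit_instance \<theta>"
    and k: "k \<noteq> best_arm \<theta>" and e: "0 < e" "e < 1"
  shows "eventually (\<lambda>T. (1 - e) * ln T / (ln (1 + (gap \<theta> k)\<^sup>2 / (residual_sd \<theta> k)\<^sup>2) / 2) \<le>
    expected_pulls N \<theta> \<pi> T k) sequentially"
proof -
  define v where "v = residual_sd \<theta> k"
  define \<Delta> where "\<Delta> = gap \<theta> k"
  define d where "d \<epsilon> = ln (1 + (\<Delta> + \<epsilon>)\<^sup>2 / v\<^sup>2) / 2" for \<epsilon>
  have v: "v > 0" and \<Delta>: "\<Delta> > 0"
    using residual_sd_pos[OF inst] gap_pos[OF inst k] by (simp_all add: v_def \<Delta>_def)
  have d_pos: "d \<epsilon> > 0" if "\<epsilon> \<ge> 0" for \<epsilon>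
    using that v \<Delta> by (simp add: d_def add_pos_nonneg)
  have "((\<lambda>\<epsilon>. (1 - e / 2) / d \<epsilon>) \<longlongrightarrow> (1 - e / 2) / d 0) (at_right 0)"
  proof -
    have "1 + (\<Delta> + 0)\<^sup>2 / v\<^sup>2 \<noteq> 0"
      using v by (simp add: add_nonneg_eq_0_iff)
    then have "(d \<longlongrightarrow> d 0) (at_right 0)"
      unfolding d_def using v by (auto intro!: tendsto_eq_intros)
    then show ?thesis
      using d_pos[of 0] by (auto intro!: tendsto_intros)
  qed
  moreover have "(1 - e) / d 0 < (1 - e / 2) / d 0"
    using e d_pos[of 0] by (simp add: divide_strict_right_mono)
  ultimately have "eventually (\<lambda>\<epsilon>. (1 - e) / d 0 < (1 - e / 2) / d \<epsilon>) (at_right 0)"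
    by (rule order_tendstoD)
  moreover have "eventually (\<lambda>\<epsilon> :: real. 0 < \<epsilon>) (at_right 0)"
    by (simp add: eventually_at_right_less)
  ultimately obtain \<epsilon> where \<epsilon>: "0 < \<epsilon>" and d\<epsilon>: "(1 - e) / d 0 < (1 - e / 2) / d \<epsilon>"
    using eventually_happens'[OF trivial_limit_at_right_real eventually_conj] by blast
  define \<theta>' where "\<theta>' = raise_arm \<theta> k (\<Delta> + \<epsilon>)"
  have inst': "bandit_instance \<theta>'"
    unfolding \<theta>'_def using \<epsilon> by (intro bandit_instance_raise_arm inst) (simp add: \<Delta>_def gap_def)
  have small: "eventually (\<lambda>T. expected_regret N \<eta> \<pi> T \<le> c * T powr (e / 4)) sequentially"
    if "bandit_instance \<eta>" "c > 0" for \<eta> c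
  proof -
    have "expected_regret N \<eta> \<pi> \<in> o(\<lambda>T. real T powr (e / 4))"
      using good e that by (simp add: uniformly_good_def)
    from landau_o.smallD[OF this \<open>c > 0\<close>] show ?thesis
      by (rule eventually_mono) simp
  qed
  have "filterlim (\<lambda>T. ln (real T)) at_top sequentially"
    by (rule filterlim_compose[OF ln_at_top filterlim_real_sequentially])
  then have "eventually (\<lambda>T. 4 / e \<le> ln (real T)) sequentially"
    by (simp add: filterlim_at_top)
  moreover have "eventually (\<lambda>T. expected_regret N \<theta> \<pi> T \<le> \<Delta> / 4 * T powr (e / 4)) sequentially"
    "eventually (\<lambda>T. expected_regret N \<theta>' \<pi> T \<le> \<epsilon> / 4 * T powr (e / 4)) sequentially"
    by (intro small inst inst' divide_pos_pos \<Delta> \<epsilon>; simp)+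
  moreover note eventually_gt_at_top[of "0::nat"]
  ultimately show ?thesis
  proof eventually_elim
    case (elim T)
    then have regret: "expected_regret N \<theta> \<pi> T \<le> \<Delta> / 4 * T powr (e / 4)"
      "expected_regret N \<theta>' \<pi> T \<le> \<epsilon> / 4 * T powr (e / 4)"
      and T: "0 < T" and lnT: "4 / e \<le> ln (real T)" by simp_all
    let ?n = "expected_pulls N \<theta> \<pi> T k"
    have "exp (- (?n * d \<epsilon> + 1)) \<le> 2 / T * (expected_regret N \<theta> \<pi> T / \<Delta> + expected_regret N \<theta>' \<pi> T / \<epsilon>)"
      using exp_expected_pulls_le_regret[OF pol inst k \<epsilon> T]
      by (simp add: \<theta>'_def \<Delta>_def d_def v_def)
    also have "\<dots> \<le> 2 / T * (T powr (e / 4) / 4 + T powr (e / 4) / 4)"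
      using regret \<Delta> \<epsilon> T by (intro mult_left_mono add_mono) (simp_all add: pos_divide_le_eq mult.commute)
    also have "\<dots> = T powr (e / 4 - 1)"
      using T by (simp add: powr_diff)
    also have "\<dots> = exp ((e / 4 - 1) * ln T)"
      using T by (simp add: powr_def)
    finally have "- (?n * d \<epsilon> + 1) \<le> (e / 4 - 1) * ln T"
      by simp
    moreover have "1 \<le> e / 4 * ln T"
      using lnT e by (simp add: field_simps)
    ultimately have "(1 - e / 2) * ln T \<le> ?n * d \<epsilon>"
      by (simp add: algebra_simps)
    then have "(1 - e / 2) / d \<epsilon> * ln T \<le> ?n"
      using d_pos[of \<epsilon>] \<epsilon> by (simp add: pos_divide_le_eq)
    moreover have "(1 - e) / d 0 * ln T \<le> (1 - e / 2) / d \<epsilon> * ln T"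
      using d\<epsilon> lnT e by (intro mult_right_mono) (auto intro: order_trans[rotated])
    ultimately have "(1 - e) / d 0 * ln T \<le> ?n"
      by linarith
    then show ?case
      by (simp only: d_def \<Delta>_def v_def add_0_right times_divide_eq_left)
  qed
qed

theorem theorem2:
  fixes N :: "'k::finite \<Rightarrow> nat" and \<pi> :: "('u, 'k) policy" and \<theta> :: "'k bandit"
  assumes "CARD('k) \<ge> 2"
    and "is_policy N \<pi>"
    and "uniformly_good N \<pi>"
    and "bandit_instance \<theta>"
  shows "liminf (\<lambda>T. ereal (expected_regret N \<theta> \<pi> T / ln (real T)))
    \<ge> ereal (\<Sum>k\<in>UNIV - {best_arm \<theta>}.
         2 * gap \<theta> k /
         ln (1 + (gap \<theta> k)\<^sup>2 / ((sd \<theta> k)\<^sup>2 * (1 - (corr \<theta> k)\<^sup>2))))"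
proof -
  note pol = assms(2) and inst = assms(4)
  let ?S = "UNIV - {best_arm \<theta>}"
  define d where "d k = ln (1 + (gap \<theta> k)\<^sup>2 / (residual_sd \<theta> k)\<^sup>2) / 2" for k
  define C where "C = (\<Sum>k\<in>?S. gap \<theta> k / d k)"
  define l where "l = liminf (\<lambda>T. ereal (expected_regret N \<theta> \<pi> T / ln (real T)))"
  have bound: "ereal ((1 - e) * C) \<le> l" if e: "0 < e" "e < 1" for e
    unfolding l_def
  proof (rule Liminf_bounded)
    have "eventually (\<lambda>T. \<forall>k\<in>?S. (1 - e) * ln T / d k \<le> expected_pulls N \<theta> \<pi> T k) sequentially"
      unfolding d_def using eventually_expected_pulls_ge[OF pol assms(3) inst _ e]
      by (intro eventually_ball_finite) auto
    then show "eventually (\<lambda>T. ereal ((1 - e) * C) \<le> ereal (expected_regret N \<theta> \<pi> T / ln (real T))) sequentially"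
      using eventually_gt_at_top[of "1::nat"]
    proof eventually_elim
      case (elim T)
      have "(1 - e) * C * ln T = (\<Sum>k\<in>?S. gap \<theta> k * ((1 - e) * ln T / d k))"
        unfolding C_def sum_distrib_left sum_distrib_right by (intro sum.cong) simp_all
      also have "\<dots> \<le> (\<Sum>k\<in>?S. gap \<theta> k * expected_pulls N \<theta> \<pi> T k)"
        using elim by (intro sum_mono mult_left_mono gap_nonneg) simp
      also have "\<dots> \<le> expected_regret N \<theta> \<pi> T"
        unfolding expected_regret_eq[OF pol inst]
        by (intro sum_mono2) (auto intro!: mult_nonneg_nonneg gap_nonneg expected_pulls_nonneg)
      finally show ?case
        using elim by (simp add: pos_le_divide_eq)
    qed
  qed
  have "((\<lambda>e. ereal ((1 - e) * C)) \<longlongrightarrow> ereal ((1 - 0) * C)) (at_right 0)"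
    by (intro tendsto_intros)
  moreover have "eventually (\<lambda>e. ereal ((1 - e) * C) \<le> l) (at_right 0)"
    using eventually_at_right_real[of 0 1] by (rule eventually_mono) (simp_all add: bound)
  ultimately have "ereal ((1 - 0) * C) \<le> l"
    by (rule tendsto_upperbound) simp
  moreover have "C = (\<Sum>k\<in>?S. 2 * gap \<theta> k / ln (1 + (gap \<theta> k)\<^sup>2 / ((sd \<theta> k)\<^sup>2 * (1 - (corr \<theta> k)\<^sup>2))))"
    by (simp add: C_def d_def residual_sd_sq[OF inst] mult.commute)
  ultimately show ?thesis
    by (simp add: l_def)
qed

end
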